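(* Let $D=(E,\mathcal{F})$ be a binary delta-matroid in which the empty set is feasible. Then, for some non-negative integers $i,j,k$, there is a sequence of handle slides taking $D$ to $D_{i,j,0}$ if $D$ is even, or to $D_{i,0,k}$ with $k\neq 0$ if $D$ is odd. Furthermore, if some sequences of handle slides take $D$ to $D_{i,j,k}$ and to $D_{p,q,r}$, then $i=p$; consequently $D$ is taken to a unique form $D_{i,j,0}$ or $D_{i,0,k}$ by handle slides.
   Context: A set system is a pair $(E,\mathcal{F})$ with $E$ a finite set and $\mathcal{F}$ a collection of subsets of $E$. A delta-matroid is a set system with $\mathcal{F}$ non-empty satisfying: for all $X,Y\in\mathcal{F}$ and $u\in X\triangle Y$ there is $v\in X\triangle Y$ with $X\triangle\{u,v\}\in\mathcal{F}$ ($\triangle$ is symmetric difference). Elements of $\mathcal{F}$ are feasible sets. $D$ is even if all feasible sets have the same parity of cardinality, odd otherwise. For a symmetric $|E|\times|E|$ matrix $M$ over $GF(2)$ with rows and columns indexed by $E$, $D(M)$ is the set system on $E$ whose feasible sets are the $A\subseteq E$ with principal submatrix $M[A]$ non-singular ($M[\emptyset]$ counts as non-singular). The twist $D*A$ is $(E,\{A\triangle X: X\in\mathcal{F}\})$. $D$ is binary if some twist of $D$ is isomorphic to $D(M)$ for some such matrix $M$ over $GF(2)$. For distinct $a,b\in E$, the handle slide of $a$ over $b$ gives $D_{ab}=(E,\mathcal{F}_{ab})$ with $\mathcal{F}_{ab}=\mathcal{F}\triangle\{X\cup\{a\}: X\cup\{b\}\in\mathcal{F},\ X\subseteq E\setminus\{a,b\}\}$;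 a sequence of handle slides is an iteration of such operations. The direct sum of delta-matroids $(E,\mathcal{F})$, $(E',\mathcal{F}')$ with $E\cap E'=\emptyset$ is $(E\cup E',\{F\cup F': F\in\mathcal{F},F'\in\mathcal{F}'\})$. $D_{i,j,k}$ denotes the direct sum of $i$ copies of $(\{e\},\{\emptyset\})$, $j$ copies of $(\{e,f\},\{\emptyset,\{e,f\}\})$ and $k$ copies of $(\{e\},\{\emptyset,\{e\}\})$ (with disjoint ground sets, here identified with $E$). *)

theory Defs
  imports
    "HOL-Library.Z2"
    "Jordan_Normal_Form.Determinant"
    "Jordan_Normal_Form.DL_Submatrix"
begin

type_synonym 'a set_system = "'a set \<times> 'a set set"

abbreviation ground :: "'a set_system \<Rightarrow> 'a set" where
  "ground D \<equiv> fst D"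

abbreviation feasible :: "'a set_system \<Rightarrow> 'a set set" where
  "feasible D \<equiv> snd D"

definition set_system :: "'a set_system \<Rightarrow> bool" where
  "set_system D \<longleftrightarrow> finite (ground D) \<and> feasible D \<subseteq> Pow (ground D)"

text \<open>In the exchange axiom \<open>v\<close> may coincide with \<open>u\<close>.\<close>

definition delta_matroid :: "'a set_system \<Rightarrow> bool" where
  "delta_matroid D \<longleftrightarrow> set_system D \<and> feasible D \<noteq> {} \<and>
     (\<forall>X\<in>feasible D. \<forall>Y\<in>feasible D. \<forall>u\<in>sym_diff X Y. \<exists>v\<in>sym_diff X Y. sym_diff X {u, v} \<in> feasible D)"

definition even_system :: "'a set_system \<Rightarrow> bool" where
  "even_system D \<longleftrightarrow>
     (\<forall>X\<in>feasible D. \<forall>Y\<in>feasible D. even (card X) \<longleftrightarrow> even (card Y))"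

definition odd_system :: "'a set_system \<Rightarrow> bool" where
  "odd_system D \<longleftrightarrow> \<not> even_system D"

definition isomorphic :: "'a set_system \<Rightarrow> 'b set_system \<Rightarrow> bool" where
  "isomorphic D D' \<longleftrightarrow>
     (\<exists>f. bij_betw f (ground D) (ground D') \<and> feasible D' = (\<lambda>X. f ` X) ` feasible D)"

definition twist :: "'a set_system \<Rightarrow> 'a set \<Rightarrow> 'a set_system" where
  "twist D A = (ground D, {sym_diff A X | X. X \<in> feasible D})"

text \<open>
  Rows and columns of a matrix are indexed by \<open>{..<n}\<close>, which serves as the ground set of
  \<open>D(M)\<close>; arbitrary index sets are covered because binary delta-matroids are defined up to
  isomorphism. The type \<open>bit\<close> is the field with two elements. The submatrix for the
  empty set is the 0 by 0 matrix, with determinant 1.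
\<close>

definition matrix_system :: "bit mat \<Rightarrow> nat set_system" where
  "matrix_system M =
     ({..<dim_row M}, {A. A \<subseteq> {..<dim_row M} \<and> det (submatrix M A A) \<noteq> 0})"

definition binary :: "'a set_system \<Rightarrow> bool" where
  "binary D \<longleftrightarrow>
     (\<exists>A n M. A \<subseteq> ground D \<and> M \<in> carrier_mat n n \<and> transpose_mat M = M \<and>
        isomorphic (twist D A) (matrix_system M))"

definition handle_slide :: "'a \<Rightarrow> 'a \<Rightarrow> 'a set_system \<Rightarrow> 'a set_system" where
  "handle_slide a b D =
     (ground D,
      sym_diff (feasible D) {X \<union> {a} | X. X \<union> {b} \<in> feasible D \<and> X \<subseteq> ground D - {a, b}})"

inductive slides_to :: "'a set_system \<Rightarrow> 'a set_system \<Rightarrow> bool" where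
  refl: "slides_to D D"
| step: "slides_to D D' \<Longrightarrow> a \<in> ground D' \<Longrightarrow> b \<in> ground D' \<Longrightarrow> a \<noteq> b \<Longrightarrow>
    slides_to D (handle_slide a b D')"

text \<open>To be applied to set systems with disjoint ground sets only.\<close>

definition direct_sum :: "'a set_system \<Rightarrow> 'a set_system \<Rightarrow> 'a set_system" where
  "direct_sum D D' =
     (ground D \<union> ground D', {F \<union> F' | F F'. F \<in> feasible D \<and> F' \<in> feasible D'})"

text \<open>
  A copy of \<open>D\<^sub>i\<^sub>,\<^sub>j\<^sub>,\<^sub>k\<close> with ground set \<open>{..<i + 2 * j + k}\<close>; the summands
  have pairwise disjoint ground sets, and \<open>({}, {{}})\<close> is the empty direct sum.
\<close>

definition canonical_system :: "nat \<Rightarrow> nat \<Rightarrow> nat \<Rightarrow> nat set_system" where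
  "canonical_system i j k =
     foldr direct_sum
       (map (\<lambda>m. ({m}, {{}})) [0..<i] @
        map (\<lambda>m. ({i + 2 * m, i + 2 * m + 1}, {{}, {i + 2 * m, i + 2 * m + 1}})) [0..<j] @
        map (\<lambda>m. ({i + 2 * j + m}, {{}, {i + 2 * j + m}})) [0..<k])
       ({}, {{}})"

text \<open>Identifying the ground set of \<open>D\<^sub>i\<^sub>,\<^sub>j\<^sub>,\<^sub>k\<close> with that of \<open>D\<close> amounts to
  reaching \<open>D\<^sub>i\<^sub>,\<^sub>j\<^sub>,\<^sub>k\<close> up to isomorphism.\<close>

definition slides_to_canonical :: "'a set_system \<Rightarrow> nat \<Rightarrow> nat \<Rightarrow> nat \<Rightarrow> bool" where
  "slides_to_canonical D i j k \<longleftrightarrow>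
     (\<exists>D'. slides_to D D' \<and> isomorphic D' (canonical_system i j k))"

end

theory Submission
  imports Defs
begin

text \<open>
  Since the empty set is feasible, pivoting turns the twisted representation of \<open>D\<close> into a
  representation \<open>D = D(B)\<close> by a symmetric matrix \<open>B\<close> over GF(2) on the ground set itself.
  The handle slide of \<open>a\<close> over \<open>b\<close> then is the congruence adding row and column \<open>b\<close> to row
  and column \<open>a\<close>, so existence is the classification of symmetric bilinear forms over GF(2):
  an alternating form is a sum of hyperbolic planes and a zero form, any other form can be
  diagonalised. Uniqueness does not need binarity: the set of cardinalities of feasible sets is
  invariant under handle slides, and its maximum is \<open>2 j + k\<close>, with \<open>k = 0\<close> iff all of them
  are even.
\<close>

section \<open>Principal minors over GF(2)\<close>

text \<open>Non-singularity is treated as triviality of a kernel, for matrices that are functions on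
  the ground set: passing to a principal submatrix only restricts the range of summation, and no
  order of rows has to be carried along. The obstacle is the symmetric difference of families in a
  handle slide. On a set that contains \<open>a\<close> but not \<open>b\<close>, the congruence
  yields a minor that expands into four terms, of which only two are wanted; the two mixed ones are
  equal because the matrix is symmetric and cancel because 1 + 1 = 0. No pairs are left in the odd
  case because over GF(2) the sum of the form (1) and a hyperbolic plane is congruent to the sum of
  three copies of (1). Handle slides provide neither scalings nor interchanges of rows. Neither is
  missed: the only nonzero scalar is 1, and the order of the elements is absorbed by the isomorphism
  in \<open>slides_to_canonical\<close>. The full triple is unique because the ground set also
  retains its size \<open>i + 2 * j + k\<close>.\<close>

declare add_bit_eq_xor [simp del] mult_bit_eq_and [simp del]

lemma bit_add_self [simp]: "x + x = (0::bit)"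
  by (cases x) simp_all

lemma bit_add_self_left [simp]: "x + (x + y) = (y::bit)"
  by (simp flip: add.assoc)

lemma bit_add_eq_0_iff [simp]: "x + y = 0 \<longleftrightarrow> x = (y::bit)"
  by (cases x; cases y) simp_all

text \<open>Vectors are total functions of which only the values on \<open>A\<close> count. The row
  \<open>u\<close> may lie outside \<open>A\<close>, as it does when a row is split off or when all
  rows of a larger set are considered.\<close>

definition mulv :: "('a \<Rightarrow> 'a \<Rightarrow> bit) \<Rightarrow> 'a set \<Rightarrow> ('a \<Rightarrow> bit) \<Rightarrow> 'a \<Rightarrow> bit" where
  "mulv B A x u = (\<Sum>e\<in>A. B u e * x e)"

definition dot :: "'a set \<Rightarrow> ('a \<Rightarrow> bit) \<Rightarrow> ('a \<Rightarrow> bit) \<Rightarrow> bit" where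
  "dot A x y = (\<Sum>e\<in>A. x e * y e)"

text \<open>For \<open>A = {}\<close> the condition is vacuously true, in agreement with the
  determinant 1 of the empty matrix.\<close>

definition nonsing :: "('a \<Rightarrow> 'a \<Rightarrow> bit) \<Rightarrow> 'a set \<Rightarrow> bool" where
  "nonsing B A \<longleftrightarrow> (\<forall>x. (\<forall>u\<in>A. mulv B A x u = 0) \<longrightarrow> (\<forall>e\<in>A. x e = 0))"

definition sym_on_set :: "('a \<Rightarrow> 'a \<Rightarrow> bit) \<Rightarrow> 'a set \<Rightarrow> bool" where
  "sym_on_set B A \<longleftrightarrow> (\<forall>x\<in>A. \<forall>y\<in>A. B x y = B y x)"

lemma sym_on_setD: "sym_on_set B A \<Longrightarrow> x \<in> A \<Longrightarrow> y \<in> A \<Longrightarrow> B x y = B y x"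
  by (simp add: sym_on_set_def)

lemma sym_on_set_subset: "sym_on_set B A \<Longrightarrow> A' \<subseteq> A \<Longrightarrow> sym_on_set B A'"
  by (auto simp: sym_on_set_def)

lemma mulv_add: "mulv B A (\<lambda>e. x e + y e) u = mulv B A x u + mulv B A y u"
  by (simp add: mulv_def algebra_simps sum.distrib)

lemma mulv_cong:
  "\<lbrakk>\<And>e. e \<in> A \<Longrightarrow> B u e = B' u e; \<And>e. e \<in> A \<Longrightarrow> x e = y e\<rbrakk> \<Longrightarrow> mulv B A x u = mulv B' A y u"
  by (simp add: mulv_def cong: sum.cong)

lemma mulv_restrict:
  assumes "finite E" "A \<subseteq> E"
  shows "mulv B E (\<lambda>e. if e \<in> A then x e else 0) u = mulv B A x u"
proof -
  have "mulv B E (\<lambda>e. if e \<in> A then x e else 0) u = (\<Sum>e\<in>E. if e \<in> A then B u e * x e else 0)"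
    unfolding mulv_def by (intro sum.cong) auto
  then show ?thesis
    using assms by (simp add: mulv_def sum.inter_restrict[symmetric] Int_absorb1)
qed

lemma dot_commute: "dot A x y = dot A y x"
  by (simp add: dot_def mult.commute)

lemma dot_add_left: "dot A (\<lambda>e. x e + y e) z = dot A x z + dot A y z"
  by (simp add: dot_def algebra_simps sum.distrib)

lemma dot_add_right: "dot A z (\<lambda>e. x e + y e) = dot A z x + dot A z y"
  by (simp add: dot_def algebra_simps sum.distrib)

lemma dot_cong:
  "\<lbrakk>\<And>e. e \<in> A \<Longrightarrow> x e = x' e; \<And>e. e \<in> A \<Longrightarrow> y e = y' e\<rbrakk> \<Longrightarrow> dot A x y = dot A x' y'"
  by (simp add: dot_def cong: sum.cong)

lemma dot_eq_0: "(\<And>e. e \<in> A \<Longrightarrow> x e = 0) \<Longrightarrow> dot A x y = 0"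
  by (simp add: dot_def)

lemma dot_mulv_sym:
  assumes "sym_on_set B A"
  shows "dot A x (mulv B A y) = dot A y (mulv B A x)"
proof -
  have "dot A x (mulv B A y) = (\<Sum>u\<in>A. \<Sum>e\<in>A. x u * (B u e * y e))"
    by (simp add: dot_def mulv_def sum_distrib_left)
  also have "\<dots> = (\<Sum>e\<in>A. \<Sum>u\<in>A. x u * (B u e * y e))"
    by (rule sum.swap)
  also have "\<dots> = (\<Sum>e\<in>A. \<Sum>u\<in>A. y e * (B e u * x u))"
    by (intro sum.cong) (simp_all add: sym_on_setD[OF assms] mult_ac)
  finally show ?thesis
    by (simp add: dot_def mulv_def sum_distrib_left)
qed

lemma nonsing_cong:
  assumes "\<And>u e. u \<in> A \<Longrightarrow> e \<in> A \<Longrightarrow> B u e = B' u e"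
  shows "nonsing B A \<longleftrightarrow> nonsing B' A"
proof -
  have "mulv B A x u = mulv B' A x u" if "u \<in> A" for x u
    using assms that by (intro mulv_cong) auto
  then show ?thesis by (simp add: nonsing_def)
qed

section \<open>Linear algebra by counting: vectors supported on a finite set\<close>

definition vecs :: "'a set \<Rightarrow> ('a \<Rightarrow> bit) set" where
  "vecs E = {x. \<forall>e. e \<notin> E \<longrightarrow> x e = 0}"

lemma finite_vecs:
  assumes "finite E"
  shows "finite (vecs E)"
proof -
  have "finite (UNIV :: bit set)"
    by (rule finite_subset[of _ "{0, 1}"]) (use bit_not_zero_iff in auto)
  then have "finite {x. \<forall>e. (e \<in> E \<longrightarrow> x e \<in> (UNIV :: bit set)) \<and> (e \<notin> E \<longrightarrow> x e = 0)}"
    by (intro finite_set_of_finite_funs assms) auto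
  then show ?thesis by (simp add: vecs_def)
qed

text \<open>Takes the place of rank and nullity: \<open>x = y\<close> amounts to
  \<open>x + y = 0\<close>, so a trivial kernel gives injectivity, and an injective self-map of a
  finite set is surjective.\<close>

lemma additive_surj_on_vecs:
  assumes "finite E"
    and maps: "\<And>x. x \<in> vecs E \<Longrightarrow> T x \<in> vecs E"
    and add: "\<And>x y. T (\<lambda>e. x e + y e) = (\<lambda>e. T x e + T y e)"
    and ker: "\<And>x. x \<in> vecs E \<Longrightarrow> \<forall>e. T x e = 0 \<Longrightarrow> \<forall>e. x e = 0"
  shows "bij_betw T (vecs E) (vecs E)"
proof -
  have "inj_on T (vecs E)"
  proof (rule inj_onI)
    fix x y assume xy: "x \<in> vecs E" "y \<in> vecs E" "T x = T y"
    then have "(\<lambda>e. x e + y e) \<in> vecs E" "\<forall>e. T (\<lambda>e. x e + y e) e = 0"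
      by (auto simp: vecs_def add)
    from ker[OF this] show "x = y" by auto
  qed
  moreover have "T ` vecs E = vecs E"
    using finite_vecs[OF \<open>finite E\<close>] maps calculation by (intro endo_inj_surj) auto
  ultimately show ?thesis by (simp add: bij_betw_def)
qed

text \<open>Solves a linear system without an inverse matrix. The product is padded by zero outside
  \<open>A\<close> so that it becomes a self-map of \<open>vecs A\<close>.\<close>

lemma nonsing_surj:
  assumes "finite A" "nonsing B A"
  obtains s where "\<And>u. u \<in> A \<Longrightarrow> mulv B A s u = v u"
proof -
  define T where "T = (\<lambda>x u. if u \<in> A then mulv B A x u else 0)"
  have "bij_betw T (vecs A) (vecs A)"
  proof (rule additive_surj_on_vecs)
    fix x assume "x \<in> vecs A" and "\<forall>e. T x e = 0"
    then have "\<forall>u\<in>A. mulv B A x u = 0" by (metis T_def)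
    then have "\<forall>e\<in>A. x e = 0" using \<open>nonsing B A\<close> by (auto simp: nonsing_def)
    then show "\<forall>e. x e = 0" using \<open>x \<in> vecs A\<close> by (auto simp: vecs_def)
  qed (auto simp: T_def vecs_def mulv_add assms(1))
  moreover have "(\<lambda>u. if u \<in> A then v u else 0) \<in> vecs A"
    by (simp add: vecs_def)
  ultimately obtain s where "T s = (\<lambda>u. if u \<in> A then v u else 0)"
    by (metis bij_betw_imp_surj_on imageE)
  then have "mulv B A s u = v u" if "u \<in> A" for u
    using that by (metis T_def)
  then show ?thesis using that by blast
qed

text \<open>Non-singularity of the symmetric matrix with block \<open>B[A]\<close>, border
  \<open>v\<close> and corner \<open>c\<close>. The kernel vector is \<open>(x, t)\<close>, and
  signs disappear in characteristic two. Border and corner are separate arguments so that they can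
  vary while \<open>B[A]\<close> stays fixed.\<close>

definition nonsing_border :: "('a \<Rightarrow> 'a \<Rightarrow> bit) \<Rightarrow> 'a set \<Rightarrow> ('a \<Rightarrow> bit) \<Rightarrow> bit \<Rightarrow> bool" where
  "nonsing_border B A v c \<longleftrightarrow>
     (\<forall>x t. (\<forall>u\<in>A. mulv B A x u = t * v u) \<and> dot A v x = t * c \<longrightarrow> t = 0 \<and> (\<forall>e\<in>A. x e = 0))"

lemma nonsing_insert_iff_border:
  assumes "finite A" "a \<notin> A" and B: "sym_on_set B (insert a A)"
  shows "nonsing B (insert a A) \<longleftrightarrow> nonsing_border B A (\<lambda>e. B e a) (B a a)"
proof -
  have eq: "(\<forall>u\<in>insert a A. mulv B (insert a A) x u = 0) \<longleftrightarrow>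
      (\<forall>u\<in>A. mulv B A x u = x a * B u a) \<and> dot A (\<lambda>e. B e a) x = x a * B a a" for x
  proof -
    have "mulv B (insert a A) x u = mulv B A x u + x a * B u a" for u
      using assms(1,2) by (simp add: mulv_def ac_simps)
    moreover have "mulv B A x a = dot A (\<lambda>e. B e a) x"
      unfolding mulv_def dot_def by (intro sum.cong) (simp_all add: sym_on_setD[OF B])
    ultimately show ?thesis
      by auto
  qed
  show ?thesis
  proof
    assume L: "nonsing B (insert a A)"
    show "nonsing_border B A (\<lambda>e. B e a) (B a a)"
      unfolding nonsing_border_def
    proof (intro allI impI)
      fix x t
      assume x: "(\<forall>u\<in>A. mulv B A x u = t * B u a) \<and> dot A (\<lambda>e. B e a) x = t * B a a"
      have "mulv B A (x(a := t)) u = mulv B A x u" for u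
        using \<open>a \<notin> A\<close> by (intro mulv_cong) auto
      moreover have "dot A (\<lambda>e. B e a) (x(a := t)) = dot A (\<lambda>e. B e a) x"
        using \<open>a \<notin> A\<close> by (intro dot_cong) auto
      ultimately have "\<forall>u\<in>insert a A. mulv B (insert a A) (x(a := t)) u = 0"
        unfolding eq using x by simp
      then have "\<forall>e\<in>insert a A. (x(a := t)) e = 0"
        using L unfolding nonsing_def by blast
      then show "t = 0 \<and> (\<forall>e\<in>A. x e = 0)"
        using \<open>a \<notin> A\<close> by (auto split: if_splits)
    qed
  next
    assume "nonsing_border B A (\<lambda>e. B e a) (B a a)"
    then show "nonsing B (insert a A)"
      unfolding nonsing_def eq nonsing_border_def by blast
  qed
qed

text \<open>The vector \<open>s\<close> is the inverse of \<open>B[A]\<close> applied to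
  \<open>v\<close>, so \<open>c + dot A v s\<close> is the Schur complement of \<open>B[A]\<close>
  in the bordered matrix.\<close>

lemma nonsing_border_regular:
  assumes "nonsing B A" and s: "\<And>u. u \<in> A \<Longrightarrow> mulv B A s u = v u"
  shows "nonsing_border B A v c \<longleftrightarrow> c + dot A v s = 1"
proof
  assume "nonsing_border B A v c"
  \<comment> \<open>Otherwise \<open>x = s\<close> and \<open>t = 1\<close> would be a nonzero
    kernel vector of the bordered matrix.\<close>
  then have "dot A v s \<noteq> c"
    unfolding nonsing_border_def using s by (metis mult_1 zero_neq_one)
  then show "c + dot A v s = 1" by (cases c; cases "dot A v s") auto
next
  assume c: "c + dot A v s = 1"
  show "nonsing_border B A v c"
    unfolding nonsing_border_def
  proof (intro allI impI)
    fix x t assume x: "(\<forall>u\<in>A. mulv B A x u = t * v u) \<and> dot A v x = t * c"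
    show "t = 0 \<and> (\<forall>e\<in>A. x e = 0)"
    proof (cases "t = 0")
      case True
      then show ?thesis using x \<open>nonsing B A\<close> by (simp add: nonsing_def)
    next
      case False
      then have 1: "t = 1" by simp
      then have "\<forall>u\<in>A. mulv B A (\<lambda>e. x e + s e) u = 0"
        using x s by (simp add: mulv_add)
      then have "\<forall>e\<in>A. x e = s e"
        using \<open>nonsing B A\<close> by (auto simp: nonsing_def)
      then have "dot A v x = dot A v s" by (intro dot_cong) auto
      then show ?thesis using x c 1 by simp
    qed
  qed
qed

text \<open>The corner \<open>c\<close> drops out. A kernel vector with \<open>t = 1\<close> would
  mean \<open>B x = v\<close> on \<open>A\<close>, and pairing this with a kernel vector
  \<open>k\<close> of \<open>B[A]\<close> gives \<open>dot A k v = 0\<close> by symmetry, which the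
  right-hand side excludes. That right-hand side also forces the kernel to have dimension
  one.\<close>

lemma nonsing_border_singular:
  assumes "\<not> nonsing B A" and B: "sym_on_set B A"
  shows "nonsing_border B A v c \<longleftrightarrow>
    (\<forall>x. (\<forall>u\<in>A. mulv B A x u = 0) \<longrightarrow> (\<exists>e\<in>A. x e \<noteq> 0) \<longrightarrow> dot A v x = 1)"
    (is "_ \<longleftrightarrow> ?R")
proof
  assume N: "nonsing_border B A v c"
  show ?R
  proof (intro allI impI)
    fix x assume "\<forall>u\<in>A. mulv B A x u = 0" "\<exists>e\<in>A. x e \<noteq> 0"
    then have "dot A v x \<noteq> 0"
      using N unfolding nonsing_border_def by (metis mult_zero_left)
    then show "dot A v x = 1" by simp
  qed
next
  assume R: ?R
  obtain k where k: "\<forall>u\<in>A. mulv B A k u = 0" "\<exists>e\<in>A. k e \<noteq> 0"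
    using assms(1) by (auto simp: nonsing_def)
  show "nonsing_border B A v c"
    unfolding nonsing_border_def
  proof (intro allI impI)
    fix x t assume x: "(\<forall>u\<in>A. mulv B A x u = t * v u) \<and> dot A v x = t * c"
    show "t = 0 \<and> (\<forall>e\<in>A. x e = 0)"
    proof (cases "t = 0")
      case True
      then show ?thesis using x R by auto
    next
      case False
      then have 1: "t = 1" by simp
      have "dot A k v = dot A k (mulv B A x)"
        using x 1 by (intro dot_cong) auto
      also have "\<dots> = dot A (mulv B A k) x"
        using dot_mulv_sym[OF B] by (simp add: dot_commute)
      also have "\<dots> = 0"
        using k by (intro dot_eq_0) auto
      finally show ?thesis using R k by (simp add: dot_commute)
    qed
  qed
qed

text \<open>The determinant of a symmetric matrix with border \<open>v\<close> and corner \<open>c\<close> is additive in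
  \<open>(v, c)\<close> in characteristic two, since the two cross terms coincide.\<close>

lemma nonsing_border_add:
  assumes "finite A" and B: "sym_on_set B A"
  shows "nonsing_border B A (\<lambda>e. v e + w e) (c + d) \<longleftrightarrow>
    (nonsing_border B A v c \<noteq> nonsing_border B A w d)"
proof (cases "nonsing B A")
  case True
  obtain s where s: "\<And>u. u \<in> A \<Longrightarrow> mulv B A s u = v u"
    using nonsing_surj[OF \<open>finite A\<close> True] by blast
  obtain r where r: "\<And>u. u \<in> A \<Longrightarrow> mulv B A r u = w u"
    using nonsing_surj[OF \<open>finite A\<close> True] by blast
  have "dot A v r = dot A (mulv B A s) r"
    using s by (intro dot_cong) auto
  also have "\<dots> = dot A s (mulv B A r)"
    using dot_mulv_sym[OF B] by (simp add: dot_commute)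
  also have "\<dots> = dot A w s"
    using r by (subst dot_commute) (intro dot_cong; auto)
  finally have cross: "dot A v r = dot A w s" .
  have "nonsing_border B A (\<lambda>e. v e + w e) (c + d) \<longleftrightarrow>
      c + d + dot A (\<lambda>e. v e + w e) (\<lambda>e. s e + r e) = 1"
    using s r by (intro nonsing_border_regular True) (simp add: mulv_add)
  also have "c + d + dot A (\<lambda>e. v e + w e) (\<lambda>e. s e + r e) =
      (c + dot A v s) + (d + dot A w r)"
    using cross by (simp add: dot_add_left dot_add_right ac_simps)
  finally show ?thesis
    using nonsing_border_regular[OF True s, of c] nonsing_border_regular[OF True r, of d]
    by (cases "c + dot A v s"; cases "d + dot A w r") auto
next
  case False
  define K where "K = {x. (\<forall>u\<in>A. mulv B A x u = 0) \<and> (\<exists>e\<in>A. x e \<noteq> 0)}"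
  obtain k where k: "k \<in> K" using False by (auto simp: nonsing_def K_def)
  have N: "nonsing_border B A v c \<longleftrightarrow> (\<forall>x\<in>K. dot A v x = 1)" for v c
    using nonsing_border_singular[OF False B] by (auto simp: K_def)
  \<comment> \<open>If \<open>x\<close> and \<open>k\<close> differed on \<open>A\<close>, their sum
    would lie in \<open>K\<close> as well, but \<open>v\<close> pairs with it to 1 + 1 = 0. So
    \<open>K\<close> is a single vector up to values outside \<open>A\<close>.\<close>
  have unique: "dot A y x = dot A y k" if "\<forall>x\<in>K. dot A v x = 1" "x \<in> K" for v x y
  proof -
    have "(\<lambda>e. x e + k e) \<notin> K"
    proof
      assume "(\<lambda>e. x e + k e) \<in> K"
      then have "dot A v (\<lambda>e. x e + k e) = 1" using that by blast
      then show False using that k by (simp add: dot_add_right)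
    qed
    then have "\<forall>e\<in>A. x e = k e"
      using that(2) k by (auto simp: K_def mulv_add)
    then show ?thesis by (intro dot_cong) auto
  qed
  have "(\<forall>x\<in>K. dot A v x + dot A w x = 1) \<longleftrightarrow>
      (\<forall>x\<in>K. dot A v x = 1) \<noteq> (\<forall>x\<in>K. dot A w x = 1)"
  \<comment> \<open>If one of the three borders pairs to 1 with all of \<open>K\<close>, everything
    can be evaluated at the single vector \<open>k\<close>. If none does, all three statements are
    false and the equivalence holds.\<close>
  proof (cases "\<exists>y\<in>{v, w, \<lambda>e. v e + w e}. \<forall>x\<in>K. dot A y x = 1")
    case True
    then have const: "(\<forall>x\<in>K. dot A y x = 1) \<longleftrightarrow> dot A y k = 1" for y
      using unique k by metis
    then show ?thesis
      unfolding dot_add_left[symmetric] const unfolding dot_add_left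
      by (cases "dot A v k"; cases "dot A w k") auto
  next
    case False
    then show ?thesis unfolding dot_add_left[symmetric] by blast
  qed
  then show ?thesis by (simp add: N dot_add_left)
qed

section \<open>Handle slides as congruences\<close>

text \<open>The matrix obtained by adding row \<open>b\<close> to row \<open>a\<close> and column \<open>b\<close> to column \<open>a\<close>.\<close>

definition slide_form :: "'a \<Rightarrow> 'a \<Rightarrow> ('a \<Rightarrow> 'a \<Rightarrow> bit) \<Rightarrow> 'a \<Rightarrow> 'a \<Rightarrow> bit" where
  "slide_form a b B x y =
     B x y + (if x = a then B b y else 0) + (if y = a then B x b else 0) +
     (if x = a \<and> y = a then B b b else 0)"

lemma slide_form_sym: "sym_on_set B E \<Longrightarrow> a \<in> E \<Longrightarrow> b \<in> E \<Longrightarrow> sym_on_set (slide_form a b B) E"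
  by (auto simp: sym_on_set_def slide_form_def)

text \<open>With both indices in \<open>A\<close> the new submatrix is congruent to the old one by
  an invertible elementary matrix, so the kernels correspond.\<close>

lemma nonsing_slide_form_both:
  assumes "finite A" "a \<in> A" "b \<in> A" "a \<noteq> b"
  shows "nonsing (slide_form a b B) A \<longleftrightarrow> nonsing B A"
proof -
  \<comment> \<open>The elementary matrix acting on vectors: adding column \<open>b\<close> to
    column \<open>a\<close> has the effect of adding \<open>x a\<close> to \<open>x b\<close>. It is
    its own inverse in characteristic two.\<close>
  define \<tau> where "\<tau> = (\<lambda>x :: 'a \<Rightarrow> bit. x(b := x b + x a))"
  have \<tau>_\<tau>: "\<tau> (\<tau> x) = x" for x
    using \<open>a \<noteq> b\<close> by (auto simp: \<tau>_def fun_eq_iff add.assoc)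
  have \<tau>0: "(\<forall>e\<in>A. \<tau> x e = 0) \<longleftrightarrow> (\<forall>e\<in>A. x e = 0)" for x
  proof
    assume L: "\<forall>e\<in>A. \<tau> x e = 0"
    then have "x a = 0" "x b + x a = 0"
      using assms by (auto simp: \<tau>_def split: if_splits)
    then show "\<forall>e\<in>A. x e = 0" using L by (auto simp: \<tau>_def split: if_splits)
  next
    assume "\<forall>e\<in>A. x e = 0"
    then show "\<forall>e\<in>A. \<tau> x e = 0" using assms by (simp add: \<tau>_def)
  qed
  have col: "mulv B A (\<tau> x) u = mulv B A x u + B u b * x a" for x u
  proof -
    have "mulv B A (\<tau> x) u = (\<Sum>e\<in>A. B u e * x e + (if e = b then B u b * x a else 0))"
      unfolding mulv_def \<tau>_def by (intro sum.cong) (auto simp: algebra_simps)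
    then show ?thesis using assms by (simp add: sum.distrib mulv_def)
  qed
  have row: "mulv (slide_form a b B) A x u =
      mulv B A (\<tau> x) u + (if u = a then mulv B A (\<tau> x) b else 0)" for x u
  proof -
    have "mulv (slide_form a b B) A x u =
        (\<Sum>e\<in>A. B u e * x e + (if u = a then B b e * x e else 0) +
          (if e = a then B u b * x a + (if u = a then B b b * x a else 0) else 0))"
      unfolding mulv_def slide_form_def by (intro sum.cong) (auto simp: algebra_simps)
    also have "\<dots> = mulv B A x u + (if u = a then mulv B A x b else 0) +
        B u b * x a + (if u = a then B b b * x a else 0)"
      using assms by (simp add: sum.distrib mulv_def add.assoc)
    finally show ?thesis by (simp add: col ac_simps)
  qed
  have ker: "(\<forall>u\<in>A. mulv (slide_form a b B) A x u = 0) \<longleftrightarrow> (\<forall>u\<in>A. mulv B A (\<tau> x) u = 0)" for x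
  proof
    assume L: "\<forall>u\<in>A. mulv (slide_form a b B) A x u = 0"
    then have "mulv B A (\<tau> x) b = 0"
      using assms unfolding row by (metis add.right_neutral)
    then show "\<forall>u\<in>A. mulv B A (\<tau> x) u = 0"
      using L unfolding row by (metis add.right_neutral)
  qed (use assms in \<open>simp add: row\<close>)
  show ?thesis
    unfolding nonsing_def ker
  proof (intro iffI allI impI)
    fix x assume "\<forall>x. (\<forall>u\<in>A. mulv B A (\<tau> x) u = 0) \<longrightarrow> (\<forall>e\<in>A. x e = 0)"
      and "\<forall>u\<in>A. mulv B A x u = 0"
    then have "\<forall>e\<in>A. \<tau> x e = 0"
      using \<tau>_\<tau>[of x] by metis
    then show "\<forall>e\<in>A. x e = 0" by (simp only: \<tau>0)
  next
    fix x assume "\<forall>x. (\<forall>u\<in>A. mulv B A x u = 0) \<longrightarrow> (\<forall>e\<in>A. x e = 0)"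
      and "\<forall>u\<in>A. mulv B A (\<tau> x) u = 0"
    then have "\<forall>e\<in>A. \<tau> x e = 0" by blast
    then show "\<forall>e\<in>A. x e = 0" by (simp only: \<tau>0)
  qed
qed

text \<open>Row \<open>b\<close> itself is absent from the submatrix, which sees over
  \<open>X\<close> the border of \<open>a\<close> plus the border of \<open>b\<close>. The corner is
  \<open>B a a + B b b\<close>, because \<open>B a b\<close> and \<open>B b a\<close> cancel.
  Additivity in border and corner then produces exactly the symmetric difference of a handle
  slide.\<close>

lemma nonsing_slide_form_single:
  assumes "finite X" "a \<notin> X" "b \<notin> X" "a \<noteq> b" and B: "sym_on_set B (insert a (insert b X))"
  shows "nonsing (slide_form a b B) (insert a X) \<longleftrightarrow>
    (nonsing B (insert a X) \<noteq> nonsing B (insert b X))"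
proof -
  let ?S = "slide_form a b B"
  have sX: "sym_on_set B X" "sym_on_set B (insert a X)" "sym_on_set B (insert b X)"
    by (auto intro: sym_on_set_subset[OF B])
  have "sym_on_set ?S (insert a (insert b X))"
    by (rule slide_form_sym[OF B]) auto
  then have sS: "sym_on_set ?S (insert a X)" by (rule sym_on_set_subset) auto
  have X: "mulv ?S X x u = mulv B X x u" if "u \<in> X" for x u
    using assms that by (intro mulv_cong) (auto simp: slide_form_def)
  have d: "dot X (\<lambda>e. ?S e a) x = dot X (\<lambda>e. B e a + B e b) x" for x
    using assms by (intro dot_cong) (auto simp: slide_form_def)
  have Sua: "?S u a = B u a + B u b" if "u \<in> X" for u
    using assms that by (auto simp: slide_form_def)
  have Saa: "?S a a = B a a + B b b"
    using sym_on_setD[OF B, of a b] by (simp add: slide_form_def ac_simps)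
  have "nonsing ?S (insert a X) \<longleftrightarrow> nonsing_border ?S X (\<lambda>e. ?S e a) (?S a a)"
    by (rule nonsing_insert_iff_border) (use assms sS in auto)
  also have "\<dots> \<longleftrightarrow> nonsing_border B X (\<lambda>e. B e a + B e b) (B a a + B b b)"
    unfolding nonsing_border_def by (simp add: X d Sua Saa)
  finally show ?thesis
    using nonsing_border_add[OF \<open>finite X\<close> sX(1)] nonsing_insert_iff_border assms sX by metis
qed

section \<open>Set systems given by the principal minors of a symmetric matrix\<close>

definition represents :: "('a \<Rightarrow> 'a \<Rightarrow> bit) \<Rightarrow> 'a set_system \<Rightarrow> bool" where
  "represents B D \<longleftrightarrow> finite (ground D) \<and> sym_on_set B (ground D) \<and>
     feasible D = {A. A \<subseteq> ground D \<and> nonsing B A}"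

lemma ground_handle_slide [simp]: "ground (handle_slide a b D) = ground D"
  by (simp add: handle_slide_def)

text \<open>The set \<open>X\<close> in the definition of a handle slide is determined by
  \<open>A\<close>: it can only be \<open>A - {a}\<close>.\<close>

lemma mem_handle_slide_iff:
  assumes "A \<subseteq> ground D" "a \<noteq> b"
  shows "A \<in> feasible (handle_slide a b D) \<longleftrightarrow>
    (A \<in> feasible D) \<noteq> (a \<in> A \<and> b \<notin> A \<and> insert b (A - {a}) \<in> feasible D)"
proof -
  have "(\<exists>X. A = X \<union> {a} \<and> X \<union> {b} \<in> feasible D \<and> X \<subseteq> ground D - {a, b}) \<longleftrightarrow>
      a \<in> A \<and> b \<notin> A \<and> insert b (A - {a}) \<in> feasible D"
  proof
    assume "\<exists>X. A = X \<union> {a} \<and> X \<union> {b} \<in> feasible D \<and> X \<subseteq> ground D - {a, b}"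
    then obtain X where X: "A = X \<union> {a}" "X \<union> {b} \<in> feasible D" "X \<subseteq> ground D - {a, b}" by blast
    then have "insert b (A - {a}) = X \<union> {b}" by auto
    then show "a \<in> A \<and> b \<notin> A \<and> insert b (A - {a}) \<in> feasible D" using X \<open>a \<noteq> b\<close> by auto
  next
    assume "a \<in> A \<and> b \<notin> A \<and> insert b (A - {a}) \<in> feasible D"
    then show "\<exists>X. A = X \<union> {a} \<and> X \<union> {b} \<in> feasible D \<and> X \<subseteq> ground D - {a, b}"
      using assms by (intro exI[of _ "A - {a}"]) auto
  qed
  then show ?thesis by (auto simp: handle_slide_def)
qed

lemma represents_handle_slide:
  assumes D: "represents B D" and "a \<in> ground D" "b \<in> ground D" "a \<noteq> b"
  shows "represents (slide_form a b B) (handle_slide a b D)"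
proof -
  let ?S = "slide_form a b B" and ?H = "handle_slide a b D"
  have fin: "finite (ground D)" and B: "sym_on_set B (ground D)"
    and F: "feasible D = {A. A \<subseteq> ground D \<and> nonsing B A}"
    using D by (auto simp: represents_def)
  have "A \<in> feasible ?H \<longleftrightarrow> nonsing ?S A" if A: "A \<subseteq> ground D" for A
  proof -
    have "finite A" using A fin finite_subset by blast
    \<comment> \<open>In turn: the submatrix does not contain the altered row; it undergoes an
      invertible congruence; it contains the sum of row \<open>a\<close> and the absent row
      \<open>b\<close>. Only in the last case can the slide toggle \<open>A\<close>.\<close>
    consider "a \<notin> A" | "a \<in> A" "b \<in> A" | "a \<in> A" "b \<notin> A" by blast
    then show ?thesis
    proof cases
      case 1
      then have "nonsing ?S A \<longleftrightarrow> nonsing B A"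
        by (intro nonsing_cong) (auto simp: slide_form_def)
      then show ?thesis using 1 A by (simp add: mem_handle_slide_iff \<open>a \<noteq> b\<close> F)
    next
      case 2
      then show ?thesis
        using A \<open>finite A\<close> \<open>a \<noteq> b\<close> by (simp add: mem_handle_slide_iff F nonsing_slide_form_both)
    next
      case 3
      let ?X = "A - {a}"
      have "sym_on_set B (insert a (insert b ?X))"
        using A assms by (intro sym_on_set_subset[OF B]) auto
      then have "nonsing ?S (insert a ?X) \<longleftrightarrow>
          (nonsing B (insert a ?X) \<noteq> nonsing B (insert b ?X))"
        using 3 \<open>finite A\<close> \<open>a \<noteq> b\<close> by (intro nonsing_slide_form_single) auto
      moreover have "insert a ?X = A" using 3 by auto
      ultimately show ?thesis
        using A 3 assms by (auto simp: mem_handle_slide_iff F)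
    qed
  qed
  moreover have "A \<subseteq> ground D" if "A \<in> feasible ?H" for A
    using that assms F by (auto simp: handle_slide_def)
  ultimately have "feasible ?H = {A. A \<subseteq> ground ?H \<and> nonsing ?S A}" by auto
  then show ?thesis
    using fin slide_form_sym[OF B] assms unfolding represents_def by simp
qed

section \<open>Pivoting\<close>

text \<open>The bridge from determinants to kernels: a determinant vanishes iff some nonzero vector
  is mapped to zero, and vectors of length \<open>k\<close> correspond to functions on
  \<open>Y\<close>.\<close>

lemma det_submatrix_nonsing:
  fixes M :: "bit mat"
  assumes M: "M \<in> carrier_mat n n" and f: "bij_betw f E {..<n}" and "Y \<subseteq> E"
  shows "det (submatrix M (f ` Y) (f ` Y)) \<noteq> 0 \<longleftrightarrow> nonsing (\<lambda>x y. M $$ (f x, f y)) Y"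
proof -
  let ?B = "\<lambda>x y. M $$ (f x, f y)" and ?I = "f ` Y"
  define k where "k = card ?I"
  define N where "N = submatrix M ?I ?I"
  define g where "g = inv_into Y f \<circ> pick ?I"
  have I: "?I \<subseteq> {..<n}"
    using f \<open>Y \<subseteq> E\<close> by (auto simp: bij_betw_def)
  then have "finite ?I" using finite_subset by blast
  have dims: "{i. i < n \<and> i \<in> ?I} = ?I" using I by auto
  have N: "N \<in> carrier_mat k k"
    using M by (auto simp: N_def k_def submatrix_def dims)
  have "bij_betw (pick ?I) {..<k} ?I"
  proof -
    have inj: "inj_on (pick ?I) {..<k}"
    proof (rule linorder_inj_onI')
      fix i j assume "i \<in> {..<k}" "j \<in> {..<k}" "i < j"
      then show "pick ?I i \<noteq> pick ?I j"
        using pick_mono_le[of j ?I i] by (simp add: k_def)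
    qed
    moreover have "pick ?I ` {..<k} \<subseteq> ?I"
      using pick_in_set_le by (auto simp: k_def)
    ultimately show ?thesis
      using \<open>finite ?I\<close> by (simp add: bij_betw_def card_subset_eq card_image k_def)
  qed
  moreover have inj: "inj_on f Y"
    using f \<open>Y \<subseteq> E\<close> by (meson bij_betw_def inj_on_subset)
  ultimately have g: "bij_betw g {..<k} Y"
    unfolding g_def by (meson bij_betw_inv_into bij_betw_trans inj_on_imp_bij_betw)
  then have gY: "g ` {..<k} = Y" and inj_g: "inj_on g {..<k}"
    by (auto simp: bij_betw_def)
  have fg: "f (g i) = pick ?I i" if "i < k" for i
    using that pick_in_set_le[of i ?I] by (simp add: g_def f_inv_into_f k_def)
  have mv: "(N *\<^sub>v vec k (\<lambda>i. x (g i))) $ i = mulv ?B Y x (g i)" if "i < k" for i x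
  proof -
    have "(N *\<^sub>v vec k (\<lambda>i. x (g i))) $ i = (\<Sum>j<k. ?B (g i) (g j) * x (g j))"
      using M N that
      by (auto simp: scalar_prod_def N_def submatrix_def dims k_def[symmetric] fg lessThan_atLeast0
          intro!: sum.cong)
    also have "\<dots> = mulv ?B Y x (g i)"
      unfolding mulv_def by (rule sum.reindex_bij_betw[OF g])
    finally show ?thesis .
  qed
  have vec0: "vec k (\<lambda>i. x (g i)) = 0\<^sub>v k \<longleftrightarrow> (\<forall>e\<in>Y. x e = 0)" for x :: "'a \<Rightarrow> bit"
  proof -
    have "vec k (\<lambda>i. x (g i)) = 0\<^sub>v k \<longleftrightarrow> (\<forall>i<k. x (g i) = 0)"
      by (auto simp: vec_eq_iff)
    also have "\<dots> \<longleftrightarrow> (\<forall>e\<in>g ` {..<k}. x e = 0)" by auto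
    finally show ?thesis unfolding gY .
  qed
  have mv0: "N *\<^sub>v vec k (\<lambda>i. x (g i)) = 0\<^sub>v k \<longleftrightarrow> (\<forall>u\<in>Y. mulv ?B Y x u = 0)" for x
  proof -
    have "N *\<^sub>v vec k (\<lambda>i. x (g i)) = 0\<^sub>v k \<longleftrightarrow>
        (\<forall>i<k. (N *\<^sub>v vec k (\<lambda>i. x (g i))) $ i = 0)"
      using N by (auto simp: vec_eq_iff simp del: index_mult_mat_vec)
    also have "\<dots> \<longleftrightarrow> (\<forall>i<k. mulv ?B Y x (g i) = 0)"
      by (simp add: mv del: index_mult_mat_vec)
    also have "\<dots> \<longleftrightarrow> (\<forall>u\<in>g ` {..<k}. mulv ?B Y x u = 0)" by auto
    finally show ?thesis unfolding gY .
  qed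
  have ex: "\<exists>x. v = vec k (\<lambda>i. x (g i))" if "v \<in> carrier_vec k" for v :: "bit vec"
  proof
    show "v = vec k (\<lambda>i. (\<lambda>e. v $ inv_into {..<k} g e) (g i))"
      using that inj_g by (auto simp: vec_eq_iff inv_into_f_f)
  qed
  have "det N = 0 \<longleftrightarrow> (\<exists>x. vec k (\<lambda>i. x (g i)) \<noteq> 0\<^sub>v k \<and> N *\<^sub>v vec k (\<lambda>i. x (g i)) = 0\<^sub>v k)"
    unfolding det_0_iff_vec_prod_zero[OF N] by (metis ex vec_carrier)
  then show ?thesis
    unfolding N_def[symmetric] nonsing_def vec0 mv0 by blast
qed

text \<open>States the kernel condition on the whole of \<open>E\<close>, with one equation for each
  element: the coordinate of \<open>x\<close> vanishes off \<open>A\<close>, that of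
  \<open>B x\<close> on \<open>A\<close>. In this form a twist merely exchanges the two kinds of
  equation.\<close>

lemma nonsing_iff_vecs:
  assumes "finite E" "A \<subseteq> E"
  shows "nonsing B A \<longleftrightarrow>
    (\<forall>x\<in>vecs E. (\<forall>u\<in>E - A. x u = 0) \<and> (\<forall>u\<in>A. mulv B E x u = 0) \<longrightarrow> (\<forall>u. x u = 0))"
proof
  assume L: "nonsing B A"
  show "\<forall>x\<in>vecs E. (\<forall>u\<in>E - A. x u = 0) \<and> (\<forall>u\<in>A. mulv B E x u = 0) \<longrightarrow> (\<forall>u. x u = 0)"
  proof (intro ballI impI)
    fix x assume x: "x \<in> vecs E" "(\<forall>u\<in>E - A. x u = 0) \<and> (\<forall>u\<in>A. mulv B E x u = 0)"
    then have off: "x u = 0" if "u \<notin> A" for u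
      using that by (auto simp: vecs_def)
    then have "x = (\<lambda>e. if e \<in> A then x e else 0)" by auto
    then have "mulv B E x u = mulv B A x u" for u
      using mulv_restrict[OF assms, of B x] by metis
    then have "\<forall>e\<in>A. x e = 0" using L x by (auto simp: nonsing_def)
    then show "\<forall>u. x u = 0" using off by blast
  qed
next
  assume R: "\<forall>x\<in>vecs E. (\<forall>u\<in>E - A. x u = 0) \<and> (\<forall>u\<in>A. mulv B E x u = 0) \<longrightarrow> (\<forall>u. x u = 0)"
  show "nonsing B A"
    unfolding nonsing_def
  proof (intro allI impI)
    fix x assume "\<forall>u\<in>A. mulv B A x u = 0"
    define y where "y = (\<lambda>e. if e \<in> A then x e else 0)"
    have "\<forall>u\<in>A. mulv B E y u = 0"
      using \<open>\<forall>u\<in>A. mulv B A x u = 0\<close> by (simp add: y_def mulv_restrict[OF assms])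
    moreover have "y \<in> vecs E" "\<forall>u\<in>E - A. y u = 0"
      using \<open>A \<subseteq> E\<close> by (auto simp: vecs_def y_def)
    ultimately have "\<forall>u. y u = 0"
      using R by blast
    then show "\<forall>e\<in>A. x e = 0" unfolding y_def by metis
  qed
qed

text \<open>Principal pivoting: exchanging the two coordinates of the Lagrangian subspace
  \<open>{(x, B x)}\<close> at the elements of \<open>A\<close> yields again the graph of a symmetric matrix.\<close>

lemma nonsing_twist:
  assumes fin: "finite E" and B: "sym_on_set B E" and "A \<subseteq> E" and A: "nonsing B A"
  obtains B' where "sym_on_set B' E"
    and "\<And>Y. Y \<subseteq> E \<Longrightarrow> nonsing B (sym_diff A Y) \<longleftrightarrow> nonsing B' Y"
proof -
  \<comment> \<open>The pair \<open>(P x, Q x)\<close> is \<open>(x, B x)\<close> with the two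
    entries exchanged at the elements of \<open>A\<close>. Trivial kernel of \<open>P\<close> is
    precisely \<open>nonsing B A\<close>, so \<open>P\<close> is invertible and the exchanged space
    is again a graph.\<close>
  define P where "P = (\<lambda>x e. if e \<in> E then if e \<in> A then mulv B E x e else x e else 0)"
  define Q where "Q = (\<lambda>x e. if e \<in> A then x e else mulv B E x e)"
  have P_ker: "\<forall>e. x e = 0" if "x \<in> vecs E" "\<forall>e. P x e = 0" for x
  proof -
    have "(\<forall>u\<in>E - A. x u = 0) \<and> (\<forall>u\<in>A. mulv B E x u = 0)"
      using that(2) \<open>A \<subseteq> E\<close> unfolding P_def by (metis DiffD1 DiffD2 subsetD)
    then show ?thesis
      using A that(1) unfolding nonsing_iff_vecs[OF fin \<open>A \<subseteq> E\<close>] by blast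
  qed
  have P: "bij_betw P (vecs E) (vecs E)"
    by (rule additive_surj_on_vecs[OF fin _ _ P_ker])
      (auto simp: P_def vecs_def mulv_add fun_eq_iff)
  have P_0: "(\<forall>e. P x e = 0) \<longleftrightarrow> (\<forall>e. x e = 0)" if "x \<in> vecs E" for x
  proof
    assume "\<forall>e. x e = 0"
    then have "x = (\<lambda>e. 0)" by blast
    then show "\<forall>e. P x e = 0" by (simp add: P_def mulv_def)
  qed (rule P_ker[OF that])
  \<comment> \<open>Exchanging the entries at \<open>e\<close> for both vectors leaves the summand
    at \<open>e\<close> unchanged, so the sum equals its value for the original pairs, which is zero
    by the symmetry of \<open>B\<close>.\<close>
  have isotropic: "dot E (Q y) (P x) = dot E (P y) (Q x)" for x y
  proof -
    have "dot E (Q y) (P x) + dot E (P y) (Q x) =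
        (\<Sum>e\<in>E. Q y e * P x e + P y e * Q x e)"
      by (simp add: dot_def sum.distrib)
    also have "\<dots> = (\<Sum>e\<in>E. y e * mulv B E x e + x e * mulv B E y e)"
      by (intro sum.cong) (auto simp: P_def Q_def ac_simps)
    also have "\<dots> = dot E y (mulv B E x) + dot E x (mulv B E y)"
      by (simp add: dot_def sum.distrib)
    also have "\<dots> = 0"
      using dot_mulv_sym[OF B, of x y] by simp
    finally show ?thesis by simp
  qed
  define unit :: "'a \<Rightarrow> 'a \<Rightarrow> bit" where "unit = (\<lambda>e u. if u = e then 1 else 0)"
  define g where "g = (\<lambda>e. inv_into (vecs E) P (unit e))"
  have Pg: "P (g e) = unit e" if "e \<in> E" for e
  proof -
    have "unit e \<in> P ` vecs E"
      unfolding bij_betw_imp_surj_on[OF P] using that by (auto simp: unit_def vecs_def)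
    then show ?thesis unfolding g_def by (rule f_inv_into_f)
  qed
  have dot_unit: "dot E (unit e) x = x e" if "e \<in> E" for e x
  proof -
    have "dot E (unit e) x = (\<Sum>u\<in>E. if u = e then x u else 0)"
      unfolding dot_def unit_def by (intro sum.cong) auto
    then show ?thesis using that fin by simp
  qed
  \<comment> \<open>Column \<open>e\<close> is the image of the unit vector at \<open>e\<close>
    under the inverse of \<open>P\<close> followed by \<open>Q\<close>.\<close>
  define B' where "B' = (\<lambda>u e. Q (g e) u)"
  have B': "sym_on_set B' E"
    unfolding sym_on_set_def
  proof (intro ballI)
    fix u e assume "u \<in> E" "e \<in> E"
    then show "B' u e = B' e u"
      using isotropic[of "g e" "g u"] unfolding B'_def
      by (simp add: Pg dot_unit dot_commute[of _ _ "unit _"])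
  qed
  \<comment> \<open>Isotropy against the preimages \<open>g u\<close> of unit vectors identifies
    \<open>B'\<close> with \<open>Q\<close> after the inverse of \<open>P\<close> on all vectors,
    with no expansion of \<open>P x\<close> in unit vectors.\<close>
  have B'P: "mulv B' E (P x) u = Q x u" if "u \<in> E" for x u
  proof -
    have "B' u e = Q (g u) e" if "e \<in> E" for e
      using sym_on_setD[OF B' \<open>u \<in> E\<close> that] by (simp add: B'_def)
    then have "mulv B' E (P x) u = dot E (Q (g u)) (P x)"
      by (simp add: mulv_def dot_def)
    then show ?thesis
      using that by (simp add: isotropic Pg dot_unit)
  qed
  have "nonsing B (sym_diff A Y) \<longleftrightarrow> nonsing B' Y" if "Y \<subseteq> E" for Y
  proof -
    let ?Z = "sym_diff A Y"
    have Z: "?Z \<subseteq> E" using that \<open>A \<subseteq> E\<close> by blast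
    have swap: "(\<forall>u\<in>E - ?Z. x u = 0) \<and> (\<forall>u\<in>?Z. mulv B E x u = 0) \<longleftrightarrow>
        (\<forall>u\<in>E - Y. P x u = 0) \<and> (\<forall>u\<in>Y. mulv B' E (P x) u = 0)" for x
    proof -
      have "(\<forall>u\<in>E - ?Z. x u = 0) \<and> (\<forall>u\<in>?Z. mulv B E x u = 0) \<longleftrightarrow>
          (\<forall>u\<in>E. (u \<in> ?Z \<longrightarrow> mulv B E x u = 0) \<and> (u \<notin> ?Z \<longrightarrow> x u = 0))"
        using Z by blast
      also have "\<dots> \<longleftrightarrow> (\<forall>u\<in>E. (u \<in> Y \<longrightarrow> Q x u = 0) \<and> (u \<notin> Y \<longrightarrow> P x u = 0))"
        by (intro ball_cong refl) (auto simp: P_def Q_def)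
      also have "\<dots> \<longleftrightarrow> (\<forall>u\<in>E. (u \<in> Y \<longrightarrow> mulv B' E (P x) u = 0) \<and> (u \<notin> Y \<longrightarrow> P x u = 0))"
        by (intro ball_cong) (simp_all add: B'P)
      also have "\<dots> \<longleftrightarrow> (\<forall>u\<in>E - Y. P x u = 0) \<and> (\<forall>u\<in>Y. mulv B' E (P x) u = 0)"
        using that by blast
      finally show ?thesis .
    qed
    have "nonsing B' Y \<longleftrightarrow> (\<forall>z\<in>P ` vecs E. (\<forall>u\<in>E - Y. z u = 0) \<and>
        (\<forall>u\<in>Y. mulv B' E z u = 0) \<longrightarrow> (\<forall>u. z u = 0))"
      using P nonsing_iff_vecs[OF fin that, of B'] by (simp add: bij_betw_def)
    also have "\<dots> \<longleftrightarrow> (\<forall>x\<in>vecs E. (\<forall>u\<in>E - ?Z. x u = 0) \<and>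
        (\<forall>u\<in>?Z. mulv B E x u = 0) \<longrightarrow> (\<forall>u. x u = 0))"
      unfolding swap ball_simps(9) using P_0 by blast
    finally show ?thesis
      using nonsing_iff_vecs[OF fin Z, of B] by simp
  qed
  then show ?thesis using that B' by blast
qed

lemma binary_imp_represents:
  assumes "set_system D" "binary D" "{} \<in> feasible D"
  obtains B where "represents B D"
proof -
  let ?E = "ground D"
  obtain A n M f where A: "A \<subseteq> ?E" and M: "M \<in> carrier_mat n n" and sym: "transpose_mat M = M"
    and f: "bij_betw f (ground (twist D A)) (ground (matrix_system M))"
    and F: "feasible (matrix_system M) = (\<lambda>X. f ` X) ` feasible (twist D A)"
    using assms(2) unfolding binary_def isomorphic_def by auto
  have fin: "finite ?E" and sub: "feasible D \<subseteq> Pow ?E"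
    using assms(1) by (auto simp: set_system_def)
  have f: "bij_betw f ?E {..<n}"
    using f M by (simp add: twist_def matrix_system_def)
  define B where "B = (\<lambda>x y. M $$ (f x, f y))"
  have B: "sym_on_set B ?E"
    unfolding sym_on_set_def
  proof (intro ballI)
    fix x y assume "x \<in> ?E" "y \<in> ?E"
    then have "f x < n" "f y < n"
      using f by (auto simp: bij_betw_def)
    then have "transpose_mat M $$ (f x, f y) = M $$ (f y, f x)" using M by simp
    then show "B x y = B y x" by (simp add: sym B_def)
  qed
  have feas: "Y \<in> feasible D \<longleftrightarrow> nonsing B (sym_diff A Y)" if Y: "Y \<subseteq> ?E" for Y
  proof -
    let ?Z = "sym_diff A Y"
    have Z: "?Z \<subseteq> ?E" using Y A by blast
    have "Y \<in> feasible D \<longleftrightarrow> ?Z \<in> feasible (twist D A)"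
    proof
      assume "?Z \<in> feasible (twist D A)"
      then obtain X where "X \<in> feasible D" "?Z = sym_diff A X" by (auto simp: twist_def)
      moreover from this have "X = Y" by blast
      ultimately show "Y \<in> feasible D" by simp
    qed (auto simp: twist_def)
    also have "\<dots> \<longleftrightarrow> f ` ?Z \<in> feasible (matrix_system M)"
    proof -
      have "inj_on ((`) f) (Pow ?E)"
        using f by (simp add: bij_betw_def inj_on_image_Pow)
      moreover have "feasible (twist D A) \<subseteq> Pow ?E"
        using sub A by (auto simp: twist_def)
      ultimately show ?thesis
        unfolding F using Z by (simp add: inj_on_image_mem_iff)
    qed
    also have "\<dots> \<longleftrightarrow> nonsing B ?Z"
    proof -
      have "f ` ?Z \<subseteq> {..<dim_row M}"
        using f Z M by (auto simp: bij_betw_def)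
      then show ?thesis
        unfolding B_def det_submatrix_nonsing[OF M f Z, symmetric] by (simp add: matrix_system_def)
    qed
    finally show ?thesis .
  qed
  \<comment> \<open>The feasibility of the empty set is the statement that \<open>B[A]\<close> is
    invertible, which is what pivoting on \<open>A\<close> requires.\<close>
  have "nonsing B A" using feas[of "{}"] assms(3) by simp
  from nonsing_twist[OF fin B A this] obtain B' where
    "sym_on_set B' ?E" "\<And>Y. Y \<subseteq> ?E \<Longrightarrow> nonsing B (sym_diff A Y) \<longleftrightarrow> nonsing B' Y"
    by blast
  then have "represents B' D"
    using fin sub feas by (auto simp: represents_def)
  then show ?thesis using that by blast
qed

section \<open>Sizes of feasible sets\<close>

definition set_sizes :: "'a set_system \<Rightarrow> nat set" where
  "set_sizes D = card ` feasible D"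

lemma even_system_iff_sizes:
  assumes "{} \<in> feasible D"
  shows "even_system D \<longleftrightarrow> (\<forall>s\<in>set_sizes D. even s)"
proof
  assume "even_system D"
  then have "even (card X)" if "X \<in> feasible D" for X
    using assms that unfolding even_system_def by fastforce
  then show "\<forall>s\<in>set_sizes D. even s" by (auto simp: set_sizes_def)
qed (auto simp: set_sizes_def even_system_def)

text \<open>Toggling relates \<open>A\<close> to \<open>insert b (A - {a})\<close>, a set of the
  same size that does not contain \<open>a\<close> and hence is never toggled. So a size lost or
  gained at \<open>A\<close> is also present at this partner, before and after the slide.\<close>

lemma handle_slide_set_sizes:
  assumes D: "set_system D" and ab: "a \<in> ground D" "b \<in> ground D" "a \<noteq> b"
  shows "set_system (handle_slide a b D)" "set_sizes (handle_slide a b D) = set_sizes D"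
proof -
  let ?H = "handle_slide a b D"
  have fin: "finite (ground D)" and sub: "feasible D \<subseteq> Pow (ground D)"
    using D by (auto simp: set_system_def)
  have subH: "feasible ?H \<subseteq> Pow (ground D)"
    using sub ab by (auto simp: handle_slide_def)
  then show "set_system ?H" using fin by (simp add: set_system_def)
  have swap: "card (insert b (A - {a})) = card A" if "A \<subseteq> ground D" "a \<in> A" "b \<notin> A" for A
  proof -
    have "finite A" using that fin finite_subset by blast
    then have "card (insert b (A - {a})) = Suc (card (A - {a}))"
      using that by (intro card_insert_disjoint) auto
    also have "\<dots> = card A"
      using \<open>finite A\<close> \<open>a \<in> A\<close> by (rule card_Suc_Diff1)
    finally show ?thesis .
  qed
  have mem: "A \<in> feasible ?H \<longleftrightarrow>
      (A \<in> feasible D) \<noteq> (a \<in> A \<and> b \<notin> A \<and> insert b (A - {a}) \<in> feasible D)"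
    if "A \<subseteq> ground D" for A
    using that \<open>a \<noteq> b\<close> by (rule mem_handle_slide_iff)
  show "set_sizes ?H = set_sizes D"
    unfolding set_sizes_def
  proof (intro equalityI image_subsetI)
    fix A assume A: "A \<in> feasible ?H"
    then have "A \<subseteq> ground D" using subH by blast
    then show "card A \<in> card ` feasible D"
      using A mem[of A] swap[of A] by (metis imageI)
  next
    fix A assume A: "A \<in> feasible D"
    then have sA: "A \<subseteq> ground D" using sub by blast
    show "card A \<in> card ` feasible ?H"
    proof (cases "A \<in> feasible ?H")
      case False
      let ?C = "insert b (A - {a})"
      have C: "a \<in> A" "b \<notin> A" "?C \<in> feasible D"
        using False A mem[OF sA] by auto
      then have "?C \<in> feasible ?H"
        using mem[of ?C] sub by auto
      then show ?thesis using swap[OF sA] C by (metis imageI)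
    qed simp
  qed
qed

lemma slides_to_set_sizes:
  assumes "slides_to D D'" "set_system D"
  shows "set_system D' \<and> ground D' = ground D \<and> set_sizes D' = set_sizes D"
  using assms
proof (induction rule: slides_to.induct)
  case (step D D' a b)
  then have D': "set_system D'" "ground D' = ground D" "set_sizes D' = set_sizes D"
    by blast+
  with handle_slide_set_sizes[OF D'(1) step.hyps(2-4)] show ?case by simp
qed simp

lemma isomorphic_set_sizes:
  assumes "isomorphic D D'" "feasible D \<subseteq> Pow (ground D)"
  shows "card (ground D') = card (ground D)" "set_sizes D' = set_sizes D"
proof -
  obtain f where f: "bij_betw f (ground D) (ground D')"
    and F: "feasible D' = (\<lambda>X. f ` X) ` feasible D"
    using assms(1) by (auto simp: isomorphic_def)
  show "card (ground D') = card (ground D)"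
    using bij_betw_same_card[OF f] by simp
  have "card (f ` X) = card X" if "X \<in> feasible D" for X
    using f that assms(2) by (intro card_image) (auto simp: bij_betw_def intro: inj_on_subset)
  then show "set_sizes D' = set_sizes D"
    unfolding set_sizes_def F image_image by (intro image_cong) auto
qed

text \<open>Disjointness of the ground sets makes the decomposition \<open>F \<union> F'\<close>
  unique, its parts being the intersections with the summands. This replaces nested existential
  quantifiers by one condition for each summand.\<close>

lemma foldr_direct_sum:
  assumes "\<forall>d\<in>set Ds. feasible d \<subseteq> Pow (ground d)"
    and "sorted_wrt (\<lambda>d d'. ground d \<inter> ground d' = {}) Ds"
  shows "foldr direct_sum Ds ({}, {{}}) =
    (\<Union>d\<in>set Ds. ground d,
     {Y. Y \<subseteq> (\<Union>d\<in>set Ds. ground d) \<and> (\<forall>d\<in>set Ds. Y \<inter> ground d \<in> feasible d)})"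
  using assms
proof (induction Ds)
  case (Cons d Ds)
  let ?U = "\<Union>d\<in>set Ds. ground d"
  have disj: "ground d \<inter> ground e = {}" if "e \<in> set Ds" for e
    using Cons.prems(2) that by simp
  have sub: "feasible d \<subseteq> Pow (ground d)" using Cons.prems(1) by simp
  have eq: "foldr direct_sum (d # Ds) ({}, {{}}) =
      direct_sum d (?U, {Y. Y \<subseteq> ?U \<and> (\<forall>d\<in>set Ds. Y \<inter> ground d \<in> feasible d)})"
    using Cons by simp
  have "(\<exists>F F'. Y = F \<union> F' \<and> F \<in> feasible d \<and> F' \<subseteq> ?U \<and> (\<forall>e\<in>set Ds. F' \<inter> ground e \<in> feasible e))
      \<longleftrightarrow> Y \<subseteq> ground d \<union> ?U \<and> Y \<inter> ground d \<in> feasible d \<and> (\<forall>e\<in>set Ds. Y \<inter> ground e \<in> feasible e)"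
    (is "?L \<longleftrightarrow> ?R") for Y
  proof
    assume ?L
    then obtain F F' where Y: "Y = F \<union> F'" and F: "F \<in> feasible d"
      and F': "F' \<subseteq> ?U" "\<forall>e\<in>set Ds. F' \<inter> ground e \<in> feasible e"
      by blast
    have "F \<subseteq> ground d" using F sub by blast
    then have "Y \<inter> ground d = F"
      using Y F' disj by blast
    moreover have "Y \<inter> ground e = F' \<inter> ground e" if "e \<in> set Ds" for e
      using Y \<open>F \<subseteq> ground d\<close> disj[OF that] by blast
    ultimately show ?R using Y F F' \<open>F \<subseteq> ground d\<close> by auto
  next
    assume R: ?R
    have "(Y \<inter> ?U) \<inter> ground e = Y \<inter> ground e" if "e \<in> set Ds" for e
      using that by blast
    moreover have "Y = (Y \<inter> ground d) \<union> (Y \<inter> ?U)" using R by blast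
    ultimately show ?L
      using R by (intro exI[of _ "Y \<inter> ground d"] exI[of _ "Y \<inter> ?U"]) auto
  qed
  then have "{F \<union> F' |F F'. F \<in> feasible d \<and> F' \<subseteq> ?U \<and> (\<forall>e\<in>set Ds. F' \<inter> ground e \<in> feasible e)} =
      {Y. Y \<subseteq> ground d \<union> ?U \<and> Y \<inter> ground d \<in> feasible d \<and> (\<forall>e\<in>set Ds. Y \<inter> ground e \<in> feasible e)}"
    by (rule Collect_cong)
  then show ?case
    unfolding eq by (simp add: direct_sum_def)
qed simp

text \<open>Each summand restricts only its own block: the first \<open>i\<close> elements are
  excluded, a pair is taken as a whole or not at all, and the last \<open>k\<close> elements are
  unrestricted.\<close>

lemma canonical_system_eq:
  "canonical_system i j k = ({..<i + 2 * j + k},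
     {Y. Y \<subseteq> {i..<i + 2 * j + k} \<and> (\<forall>m<j. i + 2 * m \<in> Y \<longleftrightarrow> Suc (i + 2 * m) \<in> Y)})"
proof -
  define Ds :: "nat set_system list" where "Ds =
     map (\<lambda>m. ({m}, {{}})) [0..<i] @
     map (\<lambda>m. ({i + 2 * m, i + 2 * m + 1}, {{}, {i + 2 * m, i + 2 * m + 1}})) [0..<j] @
     map (\<lambda>m. ({i + 2 * j + m}, {{}, {i + 2 * j + m}})) [0..<k]"
  have upt: "sorted_wrt R [0..<n]" if "\<And>p q. p < q \<Longrightarrow> q < n \<Longrightarrow> R p q" for R and n :: nat
    using that by (simp add: sorted_wrt_iff_nth_less)
  have sub: "\<forall>d\<in>set Ds. feasible d \<subseteq> Pow (ground d)"
    by (auto simp: Ds_def)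
  have sorted: "sorted_wrt (\<lambda>d d'. ground d \<inter> ground d' = {}) Ds"
    unfolding Ds_def sorted_wrt_append sorted_wrt_map by (auto intro!: upt) presburger+
  have U: "(\<Union>d\<in>set Ds. ground d) = {..<i + 2 * j + k}"
  proof (intro equalityI subsetI)
    fix x assume x: "x \<in> {..<i + 2 * j + k}"
    consider "x < i" | m where "m < j" "x = i + 2 * m \<or> x = i + 2 * m + 1" | m where "m < k" "x = i + 2 * j + m"
    proof -
      assume *: "x < i \<Longrightarrow> thesis" "\<And>m. m < j \<Longrightarrow> x = i + 2 * m \<or> x = i + 2 * m + 1 \<Longrightarrow> thesis"
        "\<And>m. m < k \<Longrightarrow> x = i + 2 * j + m \<Longrightarrow> thesis"
      consider "x < i" | "i \<le> x" "x < i + 2 * j" | "i + 2 * j \<le> x" by linarith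
      then show thesis
      proof cases
        case 2
        then show thesis by (intro *(2)[of "(x - i) div 2"]) presburger+
      next
        case 3
        then show thesis using x by (intro *(3)[of "x - (i + 2 * j)"]) auto
      qed (rule *(1))
    qed
    then show "x \<in> (\<Union>d\<in>set Ds. ground d)"
      by cases (auto simp: Ds_def)
  qed (auto simp: Ds_def)
  have feas: "(\<forall>d\<in>set Ds. Y \<inter> ground d \<in> feasible d) \<longleftrightarrow>
      (\<forall>m<i. m \<notin> Y) \<and> (\<forall>m<j. i + 2 * m \<in> Y \<longleftrightarrow> Suc (i + 2 * m) \<in> Y)" for Y
  proof -
    have "Y \<inter> {p, q} \<in> {{}, {p, q}} \<longleftrightarrow> (p \<in> Y \<longleftrightarrow> q \<in> Y)" for p q :: nat by auto
    moreover have "Y \<inter> {p} \<in> {{}, {p}}" for p by auto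
    moreover have "Y \<inter> {p} \<in> {{}} \<longleftrightarrow> p \<notin> Y" for p by auto
    ultimately show ?thesis
      by (simp only: Ds_def set_append set_map ball_Un ball_simps fst_conv snd_conv)
        (auto simp: atLeast0LessThan)
  qed
  have "canonical_system i j k = foldr direct_sum Ds ({}, {{}})"
    by (simp add: canonical_system_def Ds_def)
  also have "\<dots> = ({..<i + 2 * j + k}, {Y. Y \<subseteq> {..<i + 2 * j + k} \<and>
      (\<forall>m<i. m \<notin> Y) \<and> (\<forall>m<j. i + 2 * m \<in> Y \<longleftrightarrow> Suc (i + 2 * m) \<in> Y)})"
    unfolding foldr_direct_sum[OF sub sorted] U feas by simp
  also have "\<dots> = ({..<i + 2 * j + k},
     {Y. Y \<subseteq> {i..<i + 2 * j + k} \<and> (\<forall>m<j. i + 2 * m \<in> Y \<longleftrightarrow> Suc (i + 2 * m) \<in> Y)})"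
  proof -
    have "Y \<subseteq> {..<n} \<and> (\<forall>m<i. m \<notin> Y) \<longleftrightarrow> Y \<subseteq> {i..<n}" for n and Y :: "nat set"
      by (auto simp: subset_eq) (use not_le_imp_less in blast)
    then show ?thesis by (simp add: conj_assoc[symmetric])
  qed
  finally show ?thesis .
qed

lemma canonical_size_le:
  assumes "s \<in> set_sizes (canonical_system i j k)"
  shows "s \<le> 2 * j + k"
proof -
  obtain Y where "Y \<subseteq> {i..<i + 2 * j + k}" "s = card Y"
    using assms by (auto simp: set_sizes_def canonical_system_eq)
  then show ?thesis using card_mono[of "{i..<i + 2 * j + k}" Y] by simp
qed

lemma canonical_max_size: "2 * j + k \<in> set_sizes (canonical_system i j k)"
proof -
  have "{i..<i + 2 * j + k} \<in> feasible (canonical_system i j k)"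
    by (auto simp: canonical_system_eq)
  from imageI[OF this, of card] show ?thesis by (simp add: set_sizes_def)
qed

lemma canonical_size_1:
  assumes "k \<noteq> 0"
  shows "1 \<in> set_sizes (canonical_system i j k)"
proof -
  have "{i + 2 * j} \<in> feasible (canonical_system i j k)"
    using assms by (auto simp: canonical_system_eq)
  from imageI[OF this, of card] show ?thesis by (simp add: set_sizes_def)
qed

lemma canonical_size_even:
  assumes "s \<in> set_sizes (canonical_system i j 0)"
  shows "even s"
proof -
  obtain Y where Y: "Y \<subseteq> {i..<i + 2 * j}" "\<forall>m<j. i + 2 * m \<in> Y \<longleftrightarrow> Suc (i + 2 * m) \<in> Y"
    and s: "s = card Y"
    using assms by (auto simp: set_sizes_def canonical_system_eq)
  \<comment> \<open>The indices of the pairs contained in \<open>Y\<close>; their first and second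
    members make up \<open>Y\<close>, so its size is twice that of \<open>M\<close>.\<close>
  define M where "M = {m. m < j \<and> i + 2 * m \<in> Y}"
  let ?p = "\<lambda>m. i + 2 * m" and ?q = "\<lambda>m. Suc (i + 2 * m)"
  have "y \<in> ?p ` M \<union> ?q ` M" if "y \<in> Y" for y
  proof -
    define m where "m = (y - i) div 2"
    have "y \<in> {i..<i + 2 * j}" using Y(1) that by blast
    then have "m < j" "y = ?p m \<or> y = ?q m"
      unfolding m_def by auto
    moreover from this have "m \<in> M" using Y(2) that by (auto simp: M_def)
    ultimately show ?thesis by blast
  qed
  then have "Y = ?p ` M \<union> ?q ` M" using Y(2) by (auto simp: M_def)
  moreover have "finite M" by (simp add: M_def)
  moreover have "?p ` M \<inter> ?q ` M = {}" by auto presburger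
  ultimately have "card Y = card (?p ` M) + card (?q ` M)"
    by (simp add: card_Un_disjoint)
  also have "\<dots> = 2 * card M"
    by (simp add: card_image inj_on_def)
  finally show ?thesis using s by simp
qed

section \<open>Parameters of a canonical form recovered from the original system\<close>

lemma slides_to_canonical_sizes:
  assumes "slides_to_canonical D i j k" "set_system D"
  shows "card (ground D) = i + 2 * j + k" "set_sizes D = set_sizes (canonical_system i j k)"
proof -
  obtain D' where D': "slides_to D D'" "isomorphic D' (canonical_system i j k)"
    using assms(1) by (auto simp: slides_to_canonical_def)
  then have "set_system D'" "ground D' = ground D" "set_sizes D' = set_sizes D"
    using slides_to_set_sizes assms(2) by blast+
  with isomorphic_set_sizes[OF D'(2)]
  show "card (ground D) = i + 2 * j + k" "set_sizes D = set_sizes (canonical_system i j k)"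
    by (auto simp: set_system_def canonical_system_eq)
qed

text \<open>The number \<open>i\<close> is the size of the ground set minus the largest feasible
  size: the nullity of the form.\<close>

lemma canonical_nullity_unique:
  assumes "slides_to_canonical D i j k" "slides_to_canonical D p q r" "set_system D"
  shows "i = p"
proof -
  note ijk = slides_to_canonical_sizes[OF assms(1,3)]
  note pqr = slides_to_canonical_sizes[OF assms(2,3)]
  have "2 * j + k \<le> 2 * q + r"
    using canonical_max_size canonical_size_le ijk(2) pqr(2) by metis
  moreover have "2 * q + r \<le> 2 * j + k"
    using canonical_max_size canonical_size_le ijk(2) pqr(2) by metis
  ultimately show ?thesis using ijk(1) pqr(1) by linarith
qed

lemma slides_to_canonical_even_iff:
  assumes "slides_to_canonical D i j k" "set_system D" "{} \<in> feasible D"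
  shows "even_system D \<longleftrightarrow> k = 0"
proof -
  have "even_system D \<longleftrightarrow> (\<forall>s\<in>set_sizes (canonical_system i j k). even s)"
    using even_system_iff_sizes[OF assms(3)] slides_to_canonical_sizes(2)[OF assms(1,2)] by simp
  then show ?thesis
    using canonical_size_1[of k i j] canonical_size_even[of _ i j] by (metis odd_one)
qed

section \<open>Normal forms of symmetric matrices over GF(2)\<close>

text \<open>The set \<open>R\<close> is the block still to be reduced; slides confined to it leave
  the parts already split off in place.\<close>

definition slide_step :: "'a set \<Rightarrow> ('a \<Rightarrow> 'a \<Rightarrow> bit) \<Rightarrow> ('a \<Rightarrow> 'a \<Rightarrow> bit) \<Rightarrow> bool" where
  "slide_step R B B' \<longleftrightarrow> (\<exists>a\<in>R. \<exists>b\<in>R. a \<noteq> b \<and> B' = slide_form a b B)"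

abbreviation slide_reach :: "'a set \<Rightarrow> ('a \<Rightarrow> 'a \<Rightarrow> bit) \<Rightarrow> ('a \<Rightarrow> 'a \<Rightarrow> bit) \<Rightarrow> bool" where
  "slide_reach R \<equiv> (slide_step R)\<^sup>*\<^sup>*"

lemma slide_reach_step:
  "slide_reach R B B' \<Longrightarrow> a \<in> R \<Longrightarrow> b \<in> R \<Longrightarrow> a \<noteq> b \<Longrightarrow> slide_reach R B (slide_form a b B')"
  by (erule rtranclp.rtrancl_into_rtrancl) (auto simp: slide_step_def)

lemma slide_reach_mono:
  assumes "slide_reach R B B'" "R \<subseteq> R'"
  shows "slide_reach R' B B'"
proof -
  have "slide_step R \<le> slide_step R'"
    using \<open>R \<subseteq> R'\<close> unfolding slide_step_def by blast
  then show ?thesis using rtranclp_mono assms(1) by blast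
qed

lemma slide_reach_sym: "slide_reach R B B' \<Longrightarrow> sym_on_set B R \<Longrightarrow> sym_on_set B' R"
  by (induction rule: rtranclp_induct) (auto simp: slide_step_def intro: slide_form_sym)

lemma slide_reach_outside:
  "slide_reach R B B' \<Longrightarrow> x \<notin> R \<Longrightarrow> y \<notin> R \<Longrightarrow> B' x y = B x y"
  by (induction rule: rtranclp_induct) (auto simp: slide_step_def slide_form_def)

text \<open>In row \<open>x\<close> a slide within \<open>R\<close> adds one entry of the block to
  another, and all of these are zero. So orthogonality to a part already split off persists.\<close>

lemma slide_reach_cross:
  "slide_reach R B B' \<Longrightarrow> x \<notin> R \<Longrightarrow> \<forall>y\<in>R. B x y = 0 \<Longrightarrow> \<forall>y\<in>R. B' x y = 0"
  by (induction rule: rtranclp_induct) (auto simp: slide_step_def slide_form_def)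

text \<open>The new diagonal entry at \<open>a\<close> is the sum of those at \<open>a\<close> and
  \<open>b\<close> and the equal entries \<open>C a b\<close> and \<open>C b a\<close>, which
  cancel.\<close>

lemma slide_reach_alternating:
  assumes "slide_reach R B B'" "sym_on_set B R" "\<forall>x\<in>R. B x x = 0"
  shows "\<forall>x\<in>R. B' x x = 0"
  using assms(1)
proof (induction rule: rtranclp_induct)
  case (step C C')
  have "C a b = C b a" if "a \<in> R" "b \<in> R" for a b
    using slide_reach_sym[OF step(1) assms(2)] that by (rule sym_on_setD)
  then show ?case
    using step by (auto simp: slide_step_def slide_form_def)
qed (rule assms(3))

lemma represents_slide_reach:
  assumes "slide_reach (ground D) B B'" "represents B D"
  obtains D' where "slides_to D D'" "represents B' D'"
proof -
  have "\<exists>D'. slides_to D D' \<and> ground D' = ground D \<and> represents B' D'"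
    using assms(1)
  proof (induction rule: rtranclp_induct)
    case base
    then show ?case using assms(2) slides_to.refl by blast
  next
    case (step C C')
    then obtain D' a b where D': "slides_to D D'" "ground D' = ground D" "represents C D'"
      and ab: "a \<in> ground D'" "b \<in> ground D'" "a \<noteq> b" "C' = slide_form a b C"
      by (auto simp: slide_step_def)
    then have "slides_to D (handle_slide a b D')" "represents C' (handle_slide a b D')"
      using slides_to.step[OF D'(1) ab(1-3)] represents_handle_slide[OF D'(3) ab(1-3)] ab(4) by simp_all
    then show ?case using D'(2) ground_handle_slide by metis
  qed
  then show ?thesis using that by blast
qed

text \<open>Elements with diagonal entry 1 act as loops. Sliding \<open>y\<close> over the loop
  \<open>a\<close> whenever \<open>B a y = 1\<close> clears this entry and adds
  \<open>B a a = 1\<close> to the diagonal entry of \<open>y\<close>. The diagonal is recorded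
  because later one must know which loops survive.\<close>

lemma isolate_loop:
  assumes "finite T" "a \<in> R" "T \<subseteq> R - {a}" "sym_on_set B R" "B a a = 1"
  shows "\<exists>B'. slide_reach R B B' \<and> (\<forall>y\<in>T. B' a y = 0 \<and> B' y y = B y y + B a y) \<and>
    (\<forall>y\<in>R - T. B' a y = B a y \<and> B' y y = B y y)"
  using assms(1,3)
proof (induction T)
  case empty
  then show ?case by auto
next
  case (insert y T)
  then obtain C where C: "slide_reach R B C" "\<forall>z\<in>T. C a z = 0 \<and> C z z = B z z + B a z"
    "\<forall>z\<in>R - T. C a z = B a z \<and> C z z = B z z"
    by auto
  have y: "y \<in> R - T" "y \<in> R" "y \<noteq> a" "a \<in> R - T"
    using insert.prems insert.hyps assms(2) by auto
  then have Cy: "C a a = 1" "C a y = B a y" "C y y = B y y"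
    using C(3) assms(5) by auto
  have sym: "C y a = C a y"
    using slide_reach_sym[OF C(1) assms(4)] \<open>y \<in> R\<close> assms(2) by (rule sym_on_setD)
  show ?case
  proof (cases "B a y = 0")
    case True
    then show ?thesis using C y Cy by (intro exI[of _ C]) auto
  next
    case False
    let ?C = "slide_form y a C"
    have "?C z z = C z z" "?C a z = C a z" if "z \<noteq> y" for z
      using that y by (auto simp: slide_form_def)
    moreover have "?C a y = 0" "?C y y = B y y + 1"
      using y Cy False sym by (auto simp: slide_form_def)
    moreover have "slide_reach R B ?C"
      using C(1) y assms(2) by (intro slide_reach_step) auto
    moreover have "z \<noteq> y" if "z \<in> T" for z
      using that y by auto
    ultimately show ?thesis
      using C False by (intro exI[of _ ?C]) auto
  qed
qed

lemma isolate_pair: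
  assumes "finite T" "a \<in> R" "b \<in> R" "T \<subseteq> R - {a, b}" "sym_on_set B R" "\<forall>x\<in>R. B x x = 0" "B a b = 1"
  shows "\<exists>B'. slide_reach R B B' \<and> B' a b = 1 \<and> (\<forall>y\<in>T. B' a y = 0 \<and> B' b y = 0)"
  using assms(1,4)
proof (induction T)
  case empty
  then show ?case using assms(7) by blast
next
  case (insert y T)
  then obtain C where C: "slide_reach R B C" "C a b = 1" "\<forall>z\<in>T. C a z = 0 \<and> C b z = 0"
    by auto
  have y: "y \<in> R" "y \<noteq> a" "y \<noteq> b" "y \<notin> T"
    using insert by auto
  have diag: "C a a = 0" "C b b = 0"
    using slide_reach_alternating[OF C(1) assms(5,6)] assms(2,3) by auto
  have "C b a = 1"
    using sym_on_setD[OF slide_reach_sym[OF C(1) assms(5)], of a b] C(2) assms(2,3) by simp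
  \<comment> \<open>As \<open>C a b = 1\<close> and the diagonal vanishes, sliding \<open>y\<close>
    over \<open>b\<close> changes the entry of \<open>y\<close> in row \<open>a\<close> but not in
    row \<open>b\<close>; sliding over \<open>a\<close> does the opposite. The two entries can be
    cleared independently.\<close>
  define C1 where "C1 = (if C a y = 0 then C else slide_form y b C)"
  define C2 where "C2 = (if C b y = 0 then C1 else slide_form y a C1)"
  have C1: "C1 a z = C a z" "C1 b z = C b z" if "z \<noteq> y" for z
    using that y by (auto simp: C1_def slide_form_def)
  have C1y: "C1 a y = 0" "C1 b y = C b y"
    using y diag C(2) by (auto simp: C1_def slide_form_def)
  have C2: "C2 a z = C a z" "C2 b z = C b z" if "z \<noteq> y" for z
    using that y C1 by (auto simp: C2_def slide_form_def)
  have C2y: "C2 a y = 0" "C2 b y = 0"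
    using y diag C1y C1[of a] C1[of b] \<open>C b a = 1\<close> by (auto simp: C2_def slide_form_def)
  have "slide_reach R B C1"
    unfolding C1_def using C(1) y assms(3) by (auto intro: slide_reach_step)
  then have "slide_reach R B C2"
    unfolding C2_def using y assms(2) by (auto intro: slide_reach_step)
  moreover have "C2 a b = 1" using C2 C(2) y by auto
  moreover have "\<forall>z\<in>insert y T. C2 a z = 0 \<and> C2 b z = 0"
  proof
    fix z assume "z \<in> insert y T"
    then show "C2 a z = 0 \<and> C2 b z = 0"
      using C2[of z] C2y C(3) by (cases "z = y") auto
  qed
  ultimately show ?case by blast
qed

text \<open>The shape common to both normal forms: every row has at most one 1. For symmetric
  \<open>B\<close> the ones form a matching in which an element may be matched to itself.\<close>

definition matching_form :: "('a \<Rightarrow> 'a \<Rightarrow> bit) \<Rightarrow> 'a set \<Rightarrow> bool" where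
  "matching_form B R \<longleftrightarrow> (\<forall>x\<in>R. \<forall>y\<in>R. \<forall>z\<in>R. B x y = 1 \<longrightarrow> B x z = 1 \<longrightarrow> y = z)"

lemma matching_form_subset: "matching_form B R \<Longrightarrow> R' \<subseteq> R \<Longrightarrow> matching_form B R'"
  unfolding matching_form_def by blast

text \<open>A nonzero entry \<open>B a b\<close> spans a hyperbolic plane. Once its rows are
  cleared, the recursion on the complement neither alters the plane nor brings back entries linking
  it to the rest.\<close>

lemma alternating_normal_form:
  assumes "finite R" "sym_on_set B R" "\<forall>x\<in>R. B x x = 0"
  shows "\<exists>B'. slide_reach R B B' \<and> matching_form B' R"
  using assms
proof (induction R arbitrary: B rule: finite_psubset_induct)
  case (psubset R)
  show ?case
  proof (cases "\<forall>x\<in>R. \<forall>y\<in>R. B x y = 0")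
    case True
    then show ?thesis by (auto simp: matching_form_def)
  next
    case False
    then obtain a b where ab: "a \<in> R" "b \<in> R" "B a b = 1" by auto
    then have "a \<noteq> b" using psubset.prems by auto
    let ?R = "R - {a, b}"
    obtain C where C: "slide_reach R B C" "C a b = 1" "\<forall>y\<in>?R. C a y = 0 \<and> C b y = 0"
      using isolate_pair[of ?R a R b B] ab psubset by auto
    have symC: "sym_on_set C R" and altC: "\<forall>x\<in>R. C x x = 0"
      using slide_reach_sym[OF C(1)] slide_reach_alternating[OF C(1)] psubset.prems by auto
    have "C b a = 1"
      using sym_on_setD[OF symC, of a b] ab C(2) by simp
    have "?R \<subset> R" using ab by auto
    moreover have "sym_on_set C ?R" by (rule sym_on_set_subset[OF symC]) auto
    ultimately obtain C' where C': "slide_reach ?R C C'" "matching_form C' ?R"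
      using psubset.IH[of ?R C] altC by auto
    have C'R: "slide_reach R C C'" using C'(1) by (rule slide_reach_mono) auto
    have out: "C' x y = C x y" if "x \<in> {a, b}" "y \<in> {a, b}" for x y
      using slide_reach_outside[OF C'(1)] that by auto
    have cross: "C' a y = 0 \<and> C' b y = 0" if "y \<in> ?R" for y
      using slide_reach_cross[OF C'(1), of a] slide_reach_cross[OF C'(1), of b] C(3) that by auto
    have cross': "C' y a = 0 \<and> C' y b = 0" if "y \<in> ?R" for y
      using cross[OF that] sym_on_setD[OF slide_reach_sym[OF C'R symC], of y a]
        sym_on_setD[OF slide_reach_sym[OF C'R symC], of y b] that ab by auto
    have unique: "\<exists>w. \<forall>y\<in>R. C' x y = 1 \<longrightarrow> y = w" if x: "x \<in> R" for x
    proof -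
      consider "x = a" | "x = b" | "x \<in> ?R" using x by auto
      then show ?thesis
      proof cases
        case 1
        then have "\<forall>y\<in>R. C' x y = 1 \<longrightarrow> y = b"
          using cross out[of a a] altC ab by (metis Diff_iff insert_iff empty_iff zero_neq_one)
        then show ?thesis by blast
      next
        case 2
        then have "\<forall>y\<in>R. C' x y = 1 \<longrightarrow> y = a"
          using cross out[of b b] altC ab by (metis Diff_iff insert_iff empty_iff zero_neq_one)
        then show ?thesis by blast
      next
        case 3
        then have "\<forall>y\<in>R. C' x y = 1 \<longrightarrow> y \<in> ?R"
          using cross'[OF 3] by auto
        then show ?thesis
          using 3 C'(2) unfolding matching_form_def by metis
      qed
    qed
    have "matching_form C' R"
      unfolding matching_form_def using unique by metis
    then show ?thesis using C(1) C'R by (meson rtranclp_trans)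
  qed
qed

section \<open>Diagonalisation in the presence of a loop\<close>

definition diagonal_form :: "('a \<Rightarrow> 'a \<Rightarrow> bit) \<Rightarrow> 'a set \<Rightarrow> bool" where
  "diagonal_form B R \<longleftrightarrow> (\<forall>x\<in>R. \<forall>y\<in>R. x \<noteq> y \<longrightarrow> B x y = 0)"

lemma diagonal_imp_matching: "diagonal_form B R \<Longrightarrow> matching_form B R"
  unfolding diagonal_form_def matching_form_def by (metis zero_neq_one)

lemma diagonal_form_extend:
  assumes R: "a \<in> R" "sym_on_set B R" and a: "B a a = 1" "\<forall>y\<in>R - {a}. B a y = 0"
    and B': "slide_reach (R - {a}) B B'" "diagonal_form B' (R - {a})"
  shows "slide_reach R B B'" "diagonal_form B' R" "B' a a = 1"
proof -
  show reach: "slide_reach R B B'" using B'(1) by (rule slide_reach_mono) auto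
  show "B' a a = 1" using slide_reach_outside[OF B'(1), of a a] a by simp
  have "\<forall>y\<in>R - {a}. B' a y = 0"
    using slide_reach_cross[OF B'(1), of a] a by simp
  moreover have "B' y a = B' a y" if "y \<in> R" for y
    using slide_reach_sym[OF reach R(2)] that R(1) by (rule sym_on_setD)
  ultimately show "diagonal_form B' R"
    using B'(2) by (simp add: diagonal_form_def) (metis Diff_iff singletonD)
qed

text \<open>Splitting off a loop may use up the last one and leave a nonzero alternating remainder,
  which cannot be diagonalised by itself. The loop to split off is therefore chosen so that another
  one remains, unless the remainder is zero.\<close>

lemma nonalternating_normal_form:
  assumes "finite R" "sym_on_set B R" "\<exists>a\<in>R. B a a = 1"
  shows "\<exists>B'. slide_reach R B B' \<and> diagonal_form B' R \<and> (\<exists>a\<in>R. B' a a = 1)"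
  using assms
proof (induction R arbitrary: B rule: finite_psubset_induct)
  case (psubset R)
  \<comment> \<open>The recursive step: \<open>a\<close> is isolated, and the loop \<open>q\<close>
    lets the induction hypothesis apply to \<open>R - {a}\<close>.\<close>
  have peel: ?case if C: "slide_reach R B C" and a: "a \<in> R" "C a a = 1" "\<forall>y\<in>R - {a}. C a y = 0"
    and q: "q \<in> R - {a}" "C q q = 1" for C a q
  proof -
    have symC: "sym_on_set C R" using slide_reach_sym[OF C psubset.prems(1)] .
    then have "sym_on_set C (R - {a})" by (rule sym_on_set_subset) auto
    then obtain C' where "slide_reach (R - {a}) C C'" "diagonal_form C' (R - {a})"
      using psubset.IH[of "R - {a}" C] a q by auto
    from diagonal_form_extend[OF a(1) symC a(2,3) this] show ?thesis
      using C a(1) by (meson rtranclp_trans)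
  qed
  obtain a where a: "a \<in> R" "B a a = 1" using psubset.prems by auto
  obtain C where C: "slide_reach R B C" "\<forall>y\<in>R - {a}. C a y = 0" "C a a = 1"
    using isolate_loop[of "R - {a}" a R B] a psubset by auto
  have symC: "sym_on_set C R" using slide_reach_sym[OF C(1) psubset.prems(1)] .
  consider "\<exists>q\<in>R - {a}. C q q = 1" | "\<forall>x\<in>R - {a}. \<forall>y\<in>R - {a}. C x y = 0"
    | p q where "p \<in> R - {a}" "q \<in> R - {a}" "C p q = 1" "C p p = 0" "C q q = 0"
  proof (cases "\<exists>q\<in>R - {a}. C q q = 1")
    case False
    then have "\<forall>q\<in>R - {a}. C q q = 0" by simp
    moreover assume "\<forall>x\<in>R - {a}. \<forall>y\<in>R - {a}. C x y = 0 \<Longrightarrow> thesis"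
      and "\<And>p q. \<lbrakk>p \<in> R - {a}; q \<in> R - {a}; C p q = 1; C p p = 0; C q q = 0\<rbrakk> \<Longrightarrow> thesis"
    ultimately show thesis by (meson bit_not_one_iff)
  qed
  then show ?case
  proof cases
    case 1
    then show ?thesis using peel[OF C(1) a(1) C(3,2)] by blast
  next
    case 2
    then have "diagonal_form C (R - {a})" by (auto simp: diagonal_form_def)
    from diagonal_form_extend[OF a(1) symC C(3,2) rtranclp.rtrancl_refl this]
    show ?thesis using C(1) a(1) by blast
  next
    case (3 p q)
    \<comment> \<open>Sliding \<open>p\<close> over the loop \<open>a\<close> turns \<open>p\<close> into a loop; isolating it turns \<open>q\<close> into one.\<close>
    let ?S = "slide_form p a C"
    have "p \<noteq> q" using 3 by auto
    have "C p a = 0" "C a p = 0" "C a q = 0"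
      using C(2) 3 sym_on_setD[OF symC, of p a] a(1) by auto
    then have S: "?S p p = 1" "?S p q = 1" "?S q q = 0"
      using 3 C(3) \<open>p \<noteq> q\<close> by (auto simp: slide_form_def)
    have reachS: "slide_reach R B ?S"
      using C(1) 3 a(1) by (intro slide_reach_step) auto
    have "sym_on_set ?S R" using slide_reach_sym[OF reachS psubset.prems(1)] .
    then obtain C' where C': "slide_reach R ?S C'" "\<forall>y\<in>R - {p}. C' p y = 0 \<and> C' y y = ?S y y + ?S p y"
      "C' p p = 1"
      using isolate_loop[of "R - {p}" p R ?S] S 3 psubset.hyps by auto
    have "C' q q = 1" using C'(2) S 3 \<open>p \<noteq> q\<close> by auto
    moreover have "slide_reach R B C'" using reachS C'(1) by (rule rtranclp_trans)
    ultimately show ?thesis using peel[of C' p q] C' 3 \<open>p \<noteq> q\<close> by auto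
  qed
qed

section \<open>Identification with the canonical systems\<close>

text \<open>Such a matrix is a symmetric partial permutation matrix. A zero row is also a zero
  column and puts a unit vector in the kernel; without zero rows, each equation isolates one
  coordinate.\<close>

lemma nonsing_matching_form:
  assumes "finite A" and B: "sym_on_set B A" and match: "matching_form B A"
  shows "nonsing B A \<longleftrightarrow> (\<forall>x\<in>A. \<exists>y\<in>A. B x y = 1)"
proof
  assume N: "nonsing B A"
  show "\<forall>x\<in>A. \<exists>y\<in>A. B x y = 1"
  proof (rule ccontr)
    assume "\<not> (\<forall>x\<in>A. \<exists>y\<in>A. B x y = 1)"
    then obtain x where x: "x \<in> A" "\<forall>y\<in>A. B x y = 0" by auto
    have "mulv B A (\<lambda>e. if e = x then 1 else 0) u = 0" if "u \<in> A" for u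
      unfolding mulv_def using x that sym_on_setD[OF B] by (intro sum.neutral) auto
    then have "\<forall>e\<in>A. (if e = x then 1 else 0) = (0 :: bit)"
      using N unfolding nonsing_def by blast
    from bspec[OF this x(1)] show False by simp
  qed
next
  assume R: "\<forall>x\<in>A. \<exists>y\<in>A. B x y = 1"
  show "nonsing B A"
    unfolding nonsing_def
  proof (intro allI impI ballI)
    fix x e assume x: "\<forall>u\<in>A. mulv B A x u = 0" and e: "e \<in> A"
    obtain u where u: "u \<in> A" "B e u = 1" using R e by blast
    then have "B u e = 1" using sym_on_setD[OF B e u(1)] by simp
    then have "B u e' * x e' = (if e' = e then x e else 0)" if "e' \<in> A" for e'
      using match e u(1) that unfolding matching_form_def by (cases "B u e' = 0") auto
    then have "mulv B A x u = (\<Sum>e'\<in>A. if e' = e then x e else 0)"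
      unfolding mulv_def by (intro sum.cong) auto
    then show "x e = 0" using x u(1) e \<open>finite A\<close> by simp
  qed
qed

text \<open>Provides an enumeration with matched elements next to each other, at positions
  \<open>2 * m\<close> and \<open>Suc (2 * m)\<close> as in the canonical systems.\<close>

lemma list_of_pairs:
  assumes "finite W" "sym_on_set B W" "matching_form B W" "\<forall>x\<in>W. \<exists>y\<in>W. y \<noteq> x \<and> B x y = 1"
  shows "\<exists>ws j. distinct ws \<and> set ws = W \<and> length ws = 2 * j \<and>
    (\<forall>m<j. B (ws ! (2 * m)) (ws ! Suc (2 * m)) = 1)"
  using assms
proof (induction W rule: finite_psubset_induct)
  case (psubset W)
  show ?case
  proof (cases "W = {}")
    case True
    then show ?thesis by (intro exI[of _ "[]"] exI[of _ 0]) auto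
  next
    case False
    then obtain x y where xy: "x \<in> W" "y \<in> W" "y \<noteq> x" "B x y = 1"
      using psubset.prems by blast
    have yx: "B y x = 1" using sym_on_setD[OF psubset.prems(1), of x y] xy by simp
    let ?W = "W - {x, y}"
    have "\<exists>w\<in>?W. w \<noteq> z \<and> B z w = 1" if z: "z \<in> ?W" for z
    proof -
      obtain w where w: "w \<in> W" "w \<noteq> z" "B z w = 1" using psubset.prems(3) z by blast
      then have "B w z = 1" using sym_on_setD[OF psubset.prems(1), of z w] z by simp
      then have "w \<noteq> x" "w \<noteq> y"
        using psubset.prems(2) xy yx z unfolding matching_form_def by blast+
      then show ?thesis using w by blast
    qed
    moreover have "sym_on_set B ?W" by (rule sym_on_set_subset[OF psubset.prems(1)]) auto
    moreover have "matching_form B ?W" by (rule matching_form_subset[OF psubset.prems(2)]) auto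
    moreover have "?W \<subset> W" using xy by auto
    ultimately obtain ws j where ws: "distinct ws" "set ws = ?W" "length ws = 2 * j"
      "\<forall>m<j. B (ws ! (2 * m)) (ws ! Suc (2 * m)) = 1"
      using psubset.IH[of ?W] by blast
    have "B ((x # y # ws) ! (2 * m)) ((x # y # ws) ! Suc (2 * m)) = 1" if "m < Suc j" for m
      using that ws(4) xy by (cases m) auto
    then show ?thesis
      using ws xy by (intro exI[of _ "x # y # ws"] exI[of _ "Suc j"]) auto
  qed
qed

text \<open>\<open>W\<close> and \<open>L\<close> only locate ones; that these rows vanish elsewhere
  follows from \<open>match\<close>. On both sides a set is feasible iff each of its elements has
  its partner in the set, where a loop is its own partner and a zero row has none.\<close>

lemma isomorphic_canonicalI:
  assumes D: "represents B D" and xs: "distinct xs" "set xs = ground D" "length xs = i + 2 * j + k"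
    and match: "matching_form B (ground D)"
    and Z: "\<And>p q. p < i \<Longrightarrow> q < length xs \<Longrightarrow> B (xs ! p) (xs ! q) = 0"
    and W: "\<And>m. m < j \<Longrightarrow> B (xs ! (i + 2 * m)) (xs ! Suc (i + 2 * m)) = 1"
    and L: "\<And>p. i + 2 * j \<le> p \<Longrightarrow> p < length xs \<Longrightarrow> B (xs ! p) (xs ! p) = 1"
  shows "isomorphic D (canonical_system i j k)"
proof -
  let ?n = "i + 2 * j + k" and ?C = "canonical_system i j k"
  define g where "g = nth xs"
  have g: "bij_betw g {..<?n} (ground D)"
    unfolding g_def using xs by (intro bij_betw_nth) auto
  have fin: "finite (ground D)" and B: "sym_on_set B (ground D)"
    and F: "feasible D = {A. A \<subseteq> ground D \<and> nonsing B A}"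
    using D by (auto simp: represents_def)
  have gD: "g p \<in> ground D" if "p < ?n" for p
    using g that by (auto simp: bij_betw_def)
  have unique: "q = q'" if "B (g p) (g q) = 1" "B (g p) (g q') = 1" "p < ?n" "q < ?n" "q' < ?n" for p q q'
  proof -
    have "g q = g q'"
      using match that gD unfolding matching_form_def by blast
    then show ?thesis
      using inj_onD[OF bij_betw_imp_inj_on[OF g], of q q'] that(4,5) by simp
  qed
  have W': "B (g (i + 2 * m)) (g (Suc (i + 2 * m))) = 1" "B (g (Suc (i + 2 * m))) (g (i + 2 * m)) = 1"
    if "m < j" for m
    using W[OF that] sym_on_setD[OF B gD gD, of "i + 2 * m" "Suc (i + 2 * m)"] that
    by (auto simp: g_def)
  have feas: "Y \<in> feasible ?C \<longleftrightarrow> g ` Y \<in> feasible D" if Y: "Y \<subseteq> {..<?n}" for Y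
  proof -
    have sub: "g ` Y \<subseteq> ground D" using Y gD by auto
    then have "g ` Y \<in> feasible D \<longleftrightarrow> (\<forall>x\<in>g ` Y. \<exists>y\<in>g ` Y. B x y = 1)"
      using nonsing_matching_form[OF finite_subset[OF sub fin] sym_on_set_subset[OF B sub]
        matching_form_subset[OF match sub]] F by simp
    also have "\<dots> \<longleftrightarrow> (\<forall>p\<in>Y. \<exists>q\<in>Y. B (g p) (g q) = 1)" by auto
    also have "\<dots> \<longleftrightarrow> Y \<subseteq> {i..<?n} \<and> (\<forall>m<j. i + 2 * m \<in> Y \<longleftrightarrow> Suc (i + 2 * m) \<in> Y)"
      (is "?L \<longleftrightarrow> ?R")
    proof
      assume L: ?L
      have "i \<le> p" if p: "p \<in> Y" for p
      proof (rule ccontr)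
        assume "\<not> i \<le> p"
        obtain q where "q \<in> Y" "B (g p) (g q) = 1" using bspec[OF L p] by blast
        moreover from this have "q < length xs" using Y xs(3) by auto
        ultimately show False using Z[of p q] \<open>\<not> i \<le> p\<close> by (simp add: g_def)
      qed
      moreover have "i + 2 * m \<in> Y \<longleftrightarrow> Suc (i + 2 * m) \<in> Y" if m: "m < j" for m
      proof
        assume "i + 2 * m \<in> Y"
        from bspec[OF L this] obtain q where q: "q \<in> Y" "B (g (i + 2 * m)) (g q) = 1" by blast
        have "q < ?n" using q(1) Y by auto
        then have "q = Suc (i + 2 * m)"
          using m by (intro unique[OF q(2) W'(1)[OF m]]) simp_all
        then show "Suc (i + 2 * m) \<in> Y" using q by simp
      next
        assume "Suc (i + 2 * m) \<in> Y"
        from bspec[OF L this] obtain q where q: "q \<in> Y" "B (g (Suc (i + 2 * m))) (g q) = 1" by blast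
        have "q < ?n" using q(1) Y by auto
        then have "q = i + 2 * m"
          using m by (intro unique[OF q(2) W'(2)[OF m]]) simp_all
        then show "i + 2 * m \<in> Y" using q by simp
      qed
      ultimately show ?R using Y by auto
    next
      assume R: ?R
      show ?L
      proof
        fix p assume p: "p \<in> Y"
        then have "i \<le> p" "p < ?n" using R by auto
        show "\<exists>q\<in>Y. B (g p) (g q) = 1"
        proof (cases "i + 2 * j \<le> p")
          case True
          then have "B (g p) (g p) = 1" using L[of p] xs(3) \<open>p < ?n\<close> by (simp add: g_def)
          then show ?thesis using p by blast
        next
          case False
          define m where "m = (p - i) div 2"
          have m: "m < j" "p = i + 2 * m \<or> p = Suc (i + 2 * m)"
            unfolding m_def using \<open>i \<le> p\<close> False by presburger+
          from m(2) show ?thesis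
          proof
            assume "p = i + 2 * m"
            then show ?thesis using R p m(1) W'(1)[OF m(1)] by blast
          next
            assume "p = Suc (i + 2 * m)"
            then show ?thesis using R p m(1) W'(2)[OF m(1)] by blast
          qed
        qed
      qed
    qed
    also have "\<dots> \<longleftrightarrow> Y \<in> feasible ?C" by (simp add: canonical_system_eq)
    finally show ?thesis by simp
  qed
  let ?f = "inv_into {..<?n} g"
  have f: "bij_betw ?f (ground D) {..<?n}" using g by (rule bij_betw_inv_into)
  have fg: "?f ` g ` Y = Y" if "Y \<subseteq> {..<?n}" for Y
    using g that by (simp add: bij_betw_def inv_into_image_cancel)
  have gf: "g ` ?f ` A = A" if "A \<subseteq> ground D" for A
    using g that by (simp add: bij_betw_def image_inv_into_cancel)
  have "feasible ?C = (\<lambda>X. ?f ` X) ` feasible D"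
  proof (intro equalityI subsetI)
    fix Y assume Y: "Y \<in> feasible ?C"
    then have sub: "Y \<subseteq> {..<?n}" by (auto simp: canonical_system_eq)
    then have "g ` Y \<in> feasible D" using feas Y by blast
    then show "Y \<in> (\<lambda>X. ?f ` X) ` feasible D" using fg[OF sub] by (metis imageI)
  next
    fix Y assume "Y \<in> (\<lambda>X. ?f ` X) ` feasible D"
    then obtain A where A: "A \<in> feasible D" "Y = ?f ` A" by blast
    then have "A \<subseteq> ground D" using F by blast
    moreover from this have "Y \<subseteq> {..<?n}" using A(2) f by (auto simp: bij_betw_def)
    ultimately show "Y \<in> feasible ?C" using feas[of Y] A gf by simp
  qed
  moreover have "ground ?C = {..<?n}" by (simp add: canonical_system_eq)
  ultimately show ?thesis
    unfolding isomorphic_def using f by metis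
qed

text \<open>The ground set is sorted into zero rows, elements matched to another one, and loops;
  \<open>i\<close>, \<open>j\<close> and \<open>k\<close> count the zero rows, the pairs and the
  loops.\<close>

lemma matching_form_isomorphic_canonical:
  assumes D: "represents B D" and match: "matching_form B (ground D)"
  obtains i j k where "isomorphic D (canonical_system i j k)"
    and "diagonal_form B (ground D) \<Longrightarrow> j = 0"
    and "k = 0 \<longleftrightarrow> (\<forall>x\<in>ground D. B x x = 0)"
proof -
  let ?E = "ground D"
  have fin: "finite ?E" and B: "sym_on_set B ?E"
    using D by (auto simp: represents_def)
  define Zs where "Zs = {x\<in>?E. \<forall>y\<in>?E. B x y = 0}"
  define Ls where "Ls = {x\<in>?E. B x x = 1}"
  define Ws where "Ws = ?E - Zs - Ls"
  obtain zs where zs: "distinct zs" "set zs = Zs"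
    using finite_distinct_list[of Zs] fin by (auto simp: Zs_def)
  obtain ls where ls: "distinct ls" "set ls = Ls"
    using finite_distinct_list[of Ls] fin by (auto simp: Ls_def)
  have partner: "\<exists>y\<in>Ws. y \<noteq> x \<and> B x y = 1" if x: "x \<in> Ws" for x
  proof -
    have "x \<in> ?E" "B x x = 0" using x by (auto simp: Ws_def Ls_def)
    then obtain y where y: "y \<in> ?E" "B x y = 1"
      using x by (auto simp: Ws_def Zs_def)
    have "y \<noteq> x" using y \<open>B x x = 0\<close> by auto
    have "B y x = 1" using sym_on_setD[OF B \<open>x \<in> ?E\<close> y(1)] y(2) by simp
    then have "y \<notin> Zs" using \<open>x \<in> ?E\<close> by (auto simp: Zs_def)
    \<comment> \<open>The only 1 in row \<open>y\<close> is at \<open>x\<close>, which differs from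
      \<open>y\<close>, so the diagonal entry of \<open>y\<close> is zero.\<close>
    moreover have "y \<notin> Ls"
      using \<open>B y x = 1\<close> match y(1) \<open>x \<in> ?E\<close> \<open>y \<noteq> x\<close> unfolding Ls_def matching_form_def by blast
    ultimately show ?thesis using y \<open>y \<noteq> x\<close> by (auto simp: Ws_def)
  qed
  have "finite Ws" "sym_on_set B Ws" "matching_form B Ws"
    using fin match sym_on_set_subset[OF B, of Ws] by (auto simp: Ws_def matching_form_def)
  then obtain ws j where ws: "distinct ws" "set ws = Ws" "length ws = 2 * j"
    "\<forall>m<j. B (ws ! (2 * m)) (ws ! Suc (2 * m)) = 1"
    using list_of_pairs[of Ws B] partner by auto
  let ?xs = "zs @ ws @ ls" and ?i = "length zs" and ?k = "length ls"
  have xs: "distinct ?xs" "set ?xs = ?E" "length ?xs = ?i + 2 * j + ?k"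
    using zs ws ls by (auto simp: Ws_def Zs_def Ls_def)
  have nth_E: "?xs ! q \<in> ?E" if "q < length ?xs" for q
    using that xs(2) nth_mem by blast
  have "isomorphic D (canonical_system ?i j ?k)"
  proof (rule isomorphic_canonicalI[OF D xs match])
    fix p q assume "p < ?i" "q < length ?xs"
    then have "?xs ! p \<in> Zs" using zs(2) by (auto simp: nth_append)
    then show "B (?xs ! p) (?xs ! q) = 0" using nth_E[OF \<open>q < length ?xs\<close>] by (auto simp: Zs_def)
  next
    fix m assume "m < j"
    then show "B (?xs ! (?i + 2 * m)) (?xs ! Suc (?i + 2 * m)) = 1"
      using ws(3,4) nth_append_length_plus[of zs "ws @ ls" "2 * m"]
        nth_append_length_plus[of zs "ws @ ls" "Suc (2 * m)"] by (simp add: nth_append)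
  next
    fix p assume p: "?i + 2 * j \<le> p" "p < length ?xs"
    then have "\<not> p < ?i" "\<not> p - ?i < 2 * j" by linarith+
    then have "?xs ! p = ls ! (p - ?i - 2 * j)" using ws(3) by (simp add: nth_append)
    then have "?xs ! p \<in> Ls" using p ls(2) ws(3) by auto
    then show "B (?xs ! p) (?xs ! p) = 1" by (simp add: Ls_def)
  qed
  moreover have "j = 0" if "diagonal_form B ?E"
  proof -
    have "Ws = {}"
    proof (rule ccontr)
      assume "Ws \<noteq> {}"
      then obtain x y where "x \<in> Ws" "y \<in> Ws" "y \<noteq> x" "B x y = 1" using partner by blast
      then show False using that by (auto simp: diagonal_form_def Ws_def)
    qed
    then show ?thesis using ws(2,3) by simp
  qed
  moreover have "?k = 0 \<longleftrightarrow> (\<forall>x\<in>?E. B x x = 0)"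
  proof -
    have "?k = 0 \<longleftrightarrow> Ls = {}" using ls(2) by auto
    then show ?thesis by (auto simp: Ls_def)
  qed
  ultimately show ?thesis using that by blast
qed

text \<open>A disjunction instead of a split by parity: the cases are separated by the diagonal of
  \<open>B\<close>, and which of them belongs to an even system is read off afterwards from the
  invariant sizes.\<close>

lemma represents_slides_to_canonical:
  assumes "represents B D"
  shows "(\<exists>i j. slides_to_canonical D i j 0) \<or> (\<exists>i k. k \<noteq> 0 \<and> slides_to_canonical D i 0 k)"
proof -
  let ?E = "ground D"
  have fin: "finite ?E" and B: "sym_on_set B ?E" and D: "set_system D"
    using assms by (auto simp: represents_def set_system_def)
  show ?thesis
  proof (cases "\<forall>x\<in>?E. B x x = 0")
    case True
    obtain B' where B': "slide_reach ?E B B'" "matching_form B' ?E"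
      using alternating_normal_form[OF fin B True] by blast
    obtain D' where D': "slides_to D D'" "represents B' D'"
      using represents_slide_reach[OF B'(1) assms] .
    have E: "ground D' = ?E" using slides_to_set_sizes[OF D'(1) D] by simp
    obtain i j k where "isomorphic D' (canonical_system i j k)"
      and k: "k = 0 \<longleftrightarrow> (\<forall>x\<in>ground D'. B' x x = 0)"
      using matching_form_isomorphic_canonical[OF D'(2)] B'(2) E by metis
    moreover have "k = 0"
      using slide_reach_alternating[OF B'(1) B True] by (simp add: k E)
    ultimately have "slides_to_canonical D i j 0"
      using D'(1) unfolding slides_to_canonical_def by blast
    then show ?thesis by blast
  next
    case False
    then obtain B' where B': "slide_reach ?E B B'" "diagonal_form B' ?E" "\<exists>a\<in>?E. B' a a = 1"
      using nonalternating_normal_form[OF fin B] by auto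
    obtain D' where D': "slides_to D D'" "represents B' D'"
      using represents_slide_reach[OF B'(1) assms] .
    have E: "ground D' = ?E" using slides_to_set_sizes[OF D'(1) D] by simp
    obtain i j k where iso: "isomorphic D' (canonical_system i j k)"
      and j: "diagonal_form B' (ground D') \<Longrightarrow> j = 0"
      and k: "k = 0 \<longleftrightarrow> (\<forall>x\<in>ground D'. B' x x = 0)"
      using matching_form_isomorphic_canonical[OF D'(2)] diagonal_imp_matching[OF B'(2)] E by metis
    have "j = 0" using j B'(2) E by simp
    moreover have "k \<noteq> 0" using B'(3) by (auto simp: k E)
    ultimately have "k \<noteq> 0 \<and> slides_to_canonical D i 0 k"
      using iso D'(1) unfolding slides_to_canonical_def by blast
    then show ?thesis by blast
  qed
qed

theorem theorem1p2:
  fixes D :: "'a set_system"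
  assumes "delta_matroid D"
    and "binary D"
    and "{} \<in> feasible D"
  shows "(even_system D \<longrightarrow> (\<exists>i j. slides_to_canonical D i j 0)) \<and>
    (odd_system D \<longrightarrow> (\<exists>i k. k \<noteq> 0 \<and> slides_to_canonical D i 0 k)) \<and>
    (\<forall>i j k p q r. slides_to_canonical D i j k \<longrightarrow> slides_to_canonical D p q r \<longrightarrow> i = p) \<and>
    (\<exists>!(i, j, k). (j = 0 \<or> k = 0) \<and> slides_to_canonical D i j k)"
proof -
  have D: "set_system D" using assms(1) by (simp add: delta_matroid_def)
  obtain B where "represents B D"
    using binary_imp_represents[OF D assms(2,3)] .
  note ex = represents_slides_to_canonical[OF this]
  note even = slides_to_canonical_even_iff[OF _ D assms(3)]
  note card = slides_to_canonical_sizes(1)[OF _ D]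
  note unique = canonical_nullity_unique[OF _ _ D]
  have "even_system D \<longrightarrow> (\<exists>i j. slides_to_canonical D i j 0)"
    using ex even by blast
  moreover have "odd_system D \<longrightarrow> (\<exists>i k. k \<noteq> 0 \<and> slides_to_canonical D i 0 k)"
    using ex even unfolding odd_system_def by blast
  moreover have "\<forall>i j k p q r. slides_to_canonical D i j k \<longrightarrow> slides_to_canonical D p q r \<longrightarrow> i = p"
    using unique by blast
  moreover have "\<exists>!(i, j, k). (j = 0 \<or> k = 0) \<and> slides_to_canonical D i j k"
  proof -
    obtain i j k where ijk: "j = 0 \<or> k = 0" "slides_to_canonical D i j k"
      using ex by blast
    have eq: "(p, q, r) = (i, j, k)" if pqr: "q = 0 \<or> r = 0" "slides_to_canonical D p q r" for p q r
    proof -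
      \<comment> \<open>As \<open>k\<close> and \<open>r\<close> vanish together, both triples are
        of the same type. With \<open>p = i\<close>, the size of the ground set then fixes the one
        parameter still open.\<close>
      have "p = i" "k = 0 \<longleftrightarrow> r = 0" "i + 2 * j + k = p + 2 * q + r"
        using unique[OF pqr(2) ijk(2)] even[OF ijk(2)] even[OF pqr(2)] card[OF ijk(2)] card[OF pqr(2)]
        by auto
      then show ?thesis using ijk(1) pqr(1) by auto
    qed
    show ?thesis
    proof (rule ex1I[of _ "(i, j, k)"])
      fix t assume t: "case t of (p, q, r) \<Rightarrow> (q = 0 \<or> r = 0) \<and> slides_to_canonical D p q r"
      obtain p q r where "t = (p, q, r)" by (cases t)
      with t eq[of q r p] show "t = (i, j, k)" by simp
    qed (use ijk in simp)
  qed
  ultimately show ?thesis by (intro conjI)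
qed

end
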